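(* Let $0<\lambda<\frac{2}{\sqrt{3}}-1$ and let $\mathbf{H}$ be a regular hexagon circumscribed about the unit disk $\mathbf{B}^2$ centered at the origin in $\mathbb{E}^2$. Then $$\delta_2(\lambda)=\frac{\pi}{\mathrm{area}\left(\mathbf{H}\cap(1+\lambda)\mathbf{B}^2\right)}.$$
   Context: $\mathbb{E}^2$ is the Euclidean plane and $\mathbf{B}^2$ its closed unit disk centered at the origin. A packing of $n>1$ unit disks is a family $\mathcal{P}^n=\{\mathbf{c}_i+\mathbf{B}^2: 1\le i\le n\}$ with $\|\mathbf{c}_j-\mathbf{c}_k\|\ge 2$ for all $1\le j<k\le n$. For $\lambda>0$, $$\delta_2(n,\lambda):=\max_{\mathcal{P}^n}\frac{n\pi}{\mathrm{area}\left(\bigcup_{i=1}^n(\mathbf{c}_i+(1+\lambda)\mathbf{B}^2)\right)},\qquad \delta_2(\lambda):=\limsup_{n\to+\infty}\delta_2(n,\lambda),$$ the maximum being over all packings $\mathcal{P}^n$ of $n$ unit disks in $\mathbb{E}^2$. *)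

theory Defs
  imports "HOL-Analysis.Analysis"
begin

abbreviation area :: "(real^2) set \<Rightarrow> real" where
  "area \<equiv> measure lebesgue"

text \<open>A packing of \<open>n\<close> unit disks is given by its centers \<open>c 0, \<dots>, c (n - 1)\<close>;
  the values of \<open>c\<close> at other indices are irrelevant.\<close>

definition unit_disk_packing :: "nat \<Rightarrow> (nat \<Rightarrow> real^2) \<Rightarrow> bool" where
  "unit_disk_packing n c \<longleftrightarrow> (\<forall>j k. j < k \<and> k < n \<longrightarrow> norm (c j - c k) \<ge> 2)"

definition packing_soft_density :: "nat \<Rightarrow> real \<Rightarrow> (nat \<Rightarrow> real^2) \<Rightarrow> real" where
  "packing_soft_density n lam c = real n * pi / area (\<Union>i<n. cball (c i) (1 + lam))"

text \<open>The maximum below ranges over an infinite set of reals, so the operator \<open>Max\<close> on finite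
  sets does not apply. \<open>Greatest\<close> denotes the greatest element itself, not merely a supremum.\<close>

definition max_soft_density :: "nat \<Rightarrow> real \<Rightarrow> real" where
  "max_soft_density n lam =
     (GREATEST d. d \<in> packing_soft_density n lam ` {c. unit_disk_packing n c})"

definition soft_density :: "real \<Rightarrow> ereal" where
  "soft_density lam = limsup (\<lambda>n. ereal (max_soft_density n lam))"

text \<open>A regular hexagon (with its interior) with center \<open>p\<close>, circumradius \<open>r\<close>, and a vertex in
  direction \<open>t\<close>.\<close>

definition regular_hexagon :: "(real^2) set \<Rightarrow> bool" where
  "regular_hexagon H \<longleftrightarrow>
     (\<exists>p r t. r > 0 \<and>
        H = convex hull
              ((\<lambda>k::nat. p + r *\<^sub>R vector [cos (t + real k * pi / 3), sin (t + real k * pi / 3)])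
                 ` {..<6}))"

text \<open>A polygon \<open>P\<close> is circumscribed about a disk \<open>D\<close> if it contains \<open>D\<close> and all its sides touch
  \<open>D\<close>; the facets of a polygon are its sides.\<close>

definition circumscribed_about :: "(real^2) set \<Rightarrow> (real^2) set \<Rightarrow> bool" where
  "circumscribed_about P D \<longleftrightarrow> D \<subseteq> P \<and> (\<forall>F. F facet_of P \<longrightarrow> F \<inter> D \<noteq> {})"

end

theory Submission
  imports Defs "HOL-Real_Asymp.Real_Asymp"
begin

text \<open>The part of the union of the disks of radius \<open>\<rho> = 1 + lam\<close> that lies in the Voronoi
  cell of a center is a disk with a cap cut off by each neighbour at distance \<open>< 2 \<rho>\<close>. A cap
  at distance \<open>d\<close> from the center has area at most \<open>(\<rho> - d) / (\<rho> - 1)\<close> times that of the cap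
  at distance \<open>1\<close>, and replacing \<open>\<rho>\<close> by \<open>R = 2 / sqrt 3\<close> only increases this factor. An angular
  packing argument on the circle of radius \<open>R\<close> shows that the factors \<open>(R - d) / (R - 1)\<close> sum
  to at most \<open>6\<close>, the value for a hexagon. Hence every cell has at least the area of the
  truncated hexagon, with equality in the interior of a hexagonal lattice packing.\<close>

section \<open>The neighbours of a packed disk\<close>

text \<open>The constant 2 / sqrt 3 is the circumradius of the equilateral triangle of side 2, so no
  disk of smaller radius holds three points at mutual distances \<ge> 2. This fact serves twice: it
  separates the arcs in the angular argument, and it makes the six caps of the hexagon disjoint.
  Disjointness of caps enters only for the hexagon, whose exact area is required; for a cell,
  subadditivity of area gives the lower bound. The radius \<open>R\<close> is forced: only on that
  circle does a touching neighbour have half-angle pi / 6, so that six of them fill the circle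
  exactly. The obstacle outside the cell estimate is that the density for fixed \<open>n\<close> is
  a \<open>GREATEST\<close>, which has a known value only once the maximum is attained, while
  packings do not form a compact space, because clusters can drift apart. Hence a packing of least
  area has to be constructed. The estimate from above holds for every \<open>n > 0\<close>, since
  cells at the rim are truncated by their own disks. Rim effects occur only for lattice patches, and
  as the limit is a limsup, patches with a square number of disks suffice.\<close>

lemma sum_norm_squares_ge_4:
  fixes p q r :: "'a::real_inner"
  assumes "norm (p - q) \<ge> 2" "norm (q - r) \<ge> 2" "norm (p - r) \<ge> 2"
  shows "(norm p)\<^sup>2 + (norm q)\<^sup>2 + (norm r)\<^sup>2 \<ge> 4"
proof -
  have sq: "4 \<le> (norm (p - q))\<^sup>2" "4 \<le> (norm (q - r))\<^sup>2" "4 \<le> (norm (p - r))\<^sup>2"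
    using assms power_mono[of 2 _ 2] by fastforce+
  \<comment> \<open>The three squared distances contribute at least 12 to the left side. Equality in
    the resulting bound needs p + q + r = 0, the equilateral triangle of side 2 about the
    origin.\<close>
  have eq: "(norm (p - q))\<^sup>2 + (norm (q - r))\<^sup>2 + (norm (p - r))\<^sup>2 + (norm (p + q + r))\<^sup>2
    = 3 * (norm p)\<^sup>2 + 3 * (norm q)\<^sup>2 + 3 * (norm r)\<^sup>2"
    by (simp add: power2_norm_eq_inner inner_add_left inner_add_right inner_diff_left
        inner_diff_right inner_commute)
  have "4 \<le> e + f + g"
    if "4 \<le> a" "4 \<le> b" "4 \<le> c" "a + b + c + d = 3 * e + 3 * f + 3 * g" "0 \<le> d"
    for a b c d e f g :: real
    using that by simp
  from this[OF sq eq zero_le_power2] show ?thesis .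
qed

section \<open>Disjoint arcs on a circle\<close>

lemma sum_measure_open_intervals_le:
  fixes a b :: "'i \<Rightarrow> real"
  assumes "finite I" and "\<And>i. i \<in> I \<Longrightarrow> a i \<le> b i"
    and "\<And>i j. i \<in> I \<Longrightarrow> j \<in> I \<Longrightarrow> i \<noteq> j \<Longrightarrow> {a i<..<b i} \<inter> {a j<..<b j} = {}"
    and "\<And>i. i \<in> I \<Longrightarrow> {a i<..<b i} \<subseteq> {l..u}" and "l \<le> u"
  shows "(\<Sum>i\<in>I. b i - a i) \<le> u - l"
proof -
  have "(\<Sum>i\<in>I. b i - a i) = (\<Sum>i\<in>I. measure lborel {a i<..<b i})"
    using assms(2) by (intro sum.cong) auto
  also have "\<dots> = measure lborel (\<Union>i\<in>I. {a i<..<b i})"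
    using assms(1-3)
    by (intro measure_finite_Union[symmetric]) (auto simp: disjoint_family_on_def)
  also have "\<dots> \<le> measure lborel {l..u}"
    using assms(1,4) fmeasurable_cbox[of l u]
    by (intro measure_mono_fmeasurable) (auto simp: fmeasurable_def)
  also have "\<dots> = u - l" using assms(5) by simp
  finally show ?thesis .
qed

text \<open>Unrolling \<open>M\<close> turns of the circle to a line loses at most one turn at the ends, and
  \<open>M\<close> is arbitrary.\<close>

lemma sum_arc_half_widths_le_pi:
  fixes t h :: "'i \<Rightarrow> real"
  assumes fin: "finite I"
    and t: "\<And>i. i \<in> I \<Longrightarrow> 0 \<le> t i \<and> t i < 2 * pi"
    and h: "\<And>i. i \<in> I \<Longrightarrow> 0 \<le> h i \<and> h i \<le> pi"
    and disj: "\<And>i j \<tau>. i \<in> I \<Longrightarrow> j \<in> I \<Longrightarrow> cos (\<tau> - t i) > cos (h i) \<Longrightarrow>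
      cos (\<tau> - t j) > cos (h j) \<Longrightarrow> i = j"
  shows "(\<Sum>i\<in>I. h i) \<le> pi"
proof -
  have bound: "real M * (\<Sum>i\<in>I. h i) \<le> real M * pi + pi" for M :: nat
  proof -
    \<comment> \<open>The pair (i, m) stands for the lift of arc \<open>i\<close> to turn
      \<open>m\<close> of the real line. Membership in the arc itself is expressed by
      \<open>cos\<close>, which needs no reduction modulo 2 pi.\<close>
    define a where "a = (\<lambda>(i, m::nat). t i + 2 * pi * real m - h i)"
    define b where "b = (\<lambda>(i, m::nat). t i + 2 * pi * real m + h i)"
    have arc: "cos (\<tau> - t i) > cos (h i)" if "i \<in> I" "a (i, m) < \<tau>" "\<tau> < b (i, m)" for \<tau> i m
    proof -
      have "\<bar>\<tau> - t i - 2 * pi * real m\<bar> < h i" using that by (auto simp: a_def b_def)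
      then have "cos (h i) < cos \<bar>\<tau> - t i - 2 * pi * real m\<bar>"
        using h[OF that(1)] by (intro cos_monotone_0_pi) auto
      also have "\<dots> = cos (\<tau> - t i - 2 * pi * real m)" by simp
      also have "\<dots> = cos (\<tau> - t i)"
        using cos_int_2pin[of "int m"] sin_int_2pin[of "int m"] by (simp add: cos_diff)
      finally show ?thesis .
    qed
    \<comment> \<open>Centers lie in \<open>M\<close> turns and half-widths are at most pi, so the
      lifts overhang these turns by at most pi at either end.\<close>
    have "(\<Sum>x\<in>I \<times> {..<M}. b x - a x) \<le> (2 * pi * real M + pi) - (- pi)"
    proof (rule sum_measure_open_intervals_le)
      fix x y assume x: "x \<in> I \<times> {..<M}" and y: "y \<in> I \<times> {..<M}" and "x \<noteq> y"
      show "{a x<..<b x} \<inter> {a y<..<b y} = {}"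
      proof (rule ccontr)
        assume "{a x<..<b x} \<inter> {a y<..<b y} \<noteq> {}"
        then obtain \<tau> where \<tau>: "a x < \<tau>" "\<tau> < b x" "a y < \<tau>" "\<tau> < b y"
          unfolding ex_in_conv[symmetric] Int_iff greaterThanLessThan_iff by blast
        obtain i m j k where ij: "x = (i, m)" "y = (j, k)" by (cases x, cases y) auto
        \<comment> \<open>Overlapping lifts come from the same arc, so their centers differ by a
          multiple of 2 pi that is smaller than twice the half-width, hence by 0.\<close>
        have "i = j" using disj[of i j \<tau>] arc[of i m \<tau>] arc[of j k \<tau>] x y \<tau> ij by auto
        then have "\<bar>2 * pi * real m - 2 * pi * real k\<bar> < 2 * pi"
          using \<tau> h[of i] x unfolding ij a_def b_def by auto
        then have "2 * pi * \<bar>real m - real k\<bar> < 2 * pi * 1"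
          by (simp add: abs_mult right_diff_distrib[symmetric])
        then have "\<bar>real m - real k\<bar> < 1" by simp
        then have "m = k" by linarith
        with \<open>i = j\<close> \<open>x \<noteq> y\<close> ij show False by simp
      qed
    next
      fix x assume x: "x \<in> I \<times> {..<M}"
      obtain i m where im: "x = (i, m)" by (cases x)
      have "real m + 1 \<le> real M" using x im by simp
      then have "2 * pi * (real m + 1) \<le> 2 * pi * real M" by simp
      then show "{a x<..<b x} \<subseteq> {- pi..2 * pi * real M + pi}"
        using t[of i] h[of i] x im by (auto simp: a_def b_def algebra_simps) 
          (smt (verit, best) mult_nonneg_nonneg of_nat_0_le_iff pi_ge_zero)+
    qed (use fin h in \<open>auto simp: a_def b_def\<close>)
    moreover have "(\<Sum>x\<in>I \<times> {..<M}. b x - a x) = (\<Sum>i\<in>I. \<Sum>m<M. 2 * h i)"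
      by (subst sum.cartesian_product) (simp only: a_def b_def split_def, simp)
    moreover have "(\<Sum>i\<in>I. \<Sum>m<M. 2 * h i) = 2 * (real M * (\<Sum>i\<in>I. h i))"
      by (simp add: sum_distrib_left algebra_simps)
    ultimately show ?thesis by (simp add: mult_ac)
  qed
  show ?thesis
  proof (rule ccontr)
    assume "\<not> ?thesis"
    then have "(\<Sum>i\<in>I. h i) - pi > 0" by simp
    then obtain M :: nat where "real M * ((\<Sum>i\<in>I. h i) - pi) > pi"
      using reals_Archimedean3 by blast
    with bound[of M] show False by (simp add: algebra_simps)
  qed
qed

section \<open>Polar coordinates and the weights of neighbours\<close>

definition dir :: "real \<Rightarrow> real^2" where
  "dir t = vector [cos t, sin t]"

lemma inner_dir_dir: "dir s \<bullet> dir t = cos (s - t)"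
  by (simp add: dir_def inner_vec_def sum_2 cos_diff)

lemma norm_dir [simp]: "norm (dir t) = 1"
  by (simp add: norm_eq_sqrt_inner inner_dir_dir)

lemma polar_decomposition:
  obtains t where "0 \<le> t" "t < 2 * pi" "x = norm x *\<^sub>R dir t"
proof (cases "x = 0")
  case True then show ?thesis using that[of 0] by auto
next
  case False
  have n: "(norm x)\<^sup>2 = (x$1)\<^sup>2 + (x$2)\<^sup>2"
    unfolding power2_norm_eq_inner by (simp add: inner_vec_def sum_2 power2_eq_square)
  have "(x$1 / norm x)\<^sup>2 + (x$2 / norm x)\<^sup>2 = 1"
    using False by (simp add: power_divide n[symmetric] add_divide_distrib[symmetric])
  then obtain t where t: "0 \<le> t" "t < 2 * pi" "x$1 / norm x = cos t" "x$2 / norm x = sin t"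
    by (rule sincos_total_2pi)
  have "x = norm x *\<^sub>R dir t"
    using False by (simp add: vec_eq_iff forall_2 dir_def t(3,4)[symmetric])
  with t show ?thesis using that by blast
qed

text \<open>A concave function lies above its chord, here the one between the angles 0 and pi / 6.
  Stated for \<open>cos\<close>, it lets each arc be shrunk to the half-angle
  \<open>s * pi / 6\<close>, linear in the weight, without ever mentioning arccos.\<close>

lemma cos_ge_chord:
  assumes "0 \<le> s" "s \<le> 1"
  shows "cos (s * pi / 6) \<ge> 1 - s * (1 - sqrt 3 / 2)"
proof -
  have "concave_on {0..pi/2} cos"
    unfolding concave_on_def
    by (rule convex_on_realI[where f' = sin])
      (auto intro!: derivative_eq_intros sin_monotone_2pi_le)
  from concave_onD[OF this, of s 0 "pi/6"] assms show ?thesis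
    by (simp add: cos_30 algebra_simps)
qed

text \<open>Around the origin, a point \<open>x\<close> of a packing occupies the arc of the circle of radius
  \<open>2 / sqrt 3\<close> that is closer to \<open>x\<close> than to the origin, of half-angle
  \<open>arccos (norm x * sqrt 3 / 4)\<close>. These arcs are disjoint, because three points at mutual
  distances \<open>\<ge> 2\<close> do not lie in a disk of radius less than \<open>2 / sqrt 3\<close>.
  Concavity of \<open>arccos\<close> makes the bound on their total length linear in \<open>norm x\<close>.\<close>

lemma sum_neighbour_weights_le_6:
  fixes X :: "(real^2) set"
  assumes fin: "finite X" and R: "R = 2 / sqrt 3"
    and nrm: "\<And>x. x \<in> X \<Longrightarrow> 2 \<le> norm x \<and> norm x \<le> 2 * R"
    and sep: "\<And>x y. x \<in> X \<Longrightarrow> y \<in> X \<Longrightarrow> x \<noteq> y \<Longrightarrow> norm (x - y) \<ge> 2"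
  shows "(\<Sum>x\<in>X. (R - norm x / 2) / (R - 1)) \<le> 6"
proof -
  have s3: "sqrt 3 < 2" by (rule real_less_lsqrt) auto
  then have R1: "R > 1" by (simp add: R)
  have R2: "R\<^sup>2 = 4 / 3" by (simp add: R power_divide)
  \<comment> \<open>Weight 1 belongs to a touching disk, whose half-angle is exactly pi / 6; weight
    0 belongs to distance \<open>2 * R\<close>, where the arc shrinks to a point.\<close>
  define s where "s x = (R - norm x / 2) / (R - 1)" for x :: "real^2"
  have s01: "0 \<le> s x \<and> s x \<le> 1" if "x \<in> X" for x
    using nrm[OF that] R1 by (simp add: s_def field_simps)
  have "\<exists>t. 0 \<le> t \<and> t < 2 * pi \<and> x = norm x *\<^sub>R dir t" for x
    by (meson polar_decomposition)
  then obtain t where t: "\<And>x. 0 \<le> t x \<and> t x < 2 * pi \<and> x = norm x *\<^sub>R dir (t x)" by metis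
  have key: "norm (x - R *\<^sub>R dir \<tau>) ^ 2 < 4/3" if x: "x \<in> X" and c: "cos (\<tau> - t x) > cos (s x * pi / 6)" for x \<tau>
  proof -
    have "1 - s x * (1 - sqrt 3 / 2) = norm x / (2 * R)"
    proof -
      have "1 - 1 / R = 1 - sqrt 3 / 2" by (simp add: R)
      then have "1 - s x * (1 - sqrt 3 / 2) = 1 - s x * (1 - 1 / R)" by simp
      also have "\<dots> = 1 - (R - norm x / 2) / R"
        using R1 unfolding s_def by (simp add: field_simps)
      also have "\<dots> = norm x / (2 * R)" using R1 by (simp add: field_simps)
      finally show ?thesis .
    qed
    then have "cos (\<tau> - t x) > norm x / (2 * R)"
      using c cos_ge_chord[of "s x"] s01[OF x] by auto
    then have "2 * R * cos (\<tau> - t x) > norm x" using R1 by (simp add: field_simps)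
    moreover have "norm x > 0" using nrm[OF x] by auto
    ultimately have "2 * R * cos (\<tau> - t x) * norm x > norm x * norm x" by simp
    moreover have "x \<bullet> dir \<tau> = norm x * cos (\<tau> - t x)"
      using t[of x] inner_dir_dir[of "t x" \<tau>] cos_minus[of "\<tau> - t x"]
      by (metis inner_commute inner_dir_dir inner_scaleR_right)
    moreover have "norm (x - R *\<^sub>R dir \<tau>) ^ 2 = norm x * norm x - 2 * R * (x \<bullet> dir \<tau>) + R\<^sup>2"
      unfolding power2_norm_eq_inner power2_eq_square[of "norm x", symmetric]
      by (simp add: power2_norm_eq_inner inner_diff_left inner_diff_right inner_commute
          inner_dir_dir power2_eq_square)
    ultimately show ?thesis using R2 by (simp add: mult_ac)
  qed
  have "(\<Sum>x\<in>X. s x * pi / 6) \<le> pi"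
  proof (rule sum_arc_half_widths_le_pi[OF fin, of t])
    fix x y \<tau> assume xy: "x \<in> X" "y \<in> X" and "cos (\<tau> - t x) > cos (s x * pi / 6)"
      "cos (\<tau> - t y) > cos (s y * pi / 6)"
    then have *: "norm (x - R *\<^sub>R dir \<tau>) ^ 2 < 4/3" "norm (y - R *\<^sub>R dir \<tau>) ^ 2 < 4/3" using key by auto
    show "x = y"
    proof (rule ccontr)
      assume "x \<noteq> y"
      \<comment> \<open>The third point is the origin, at distance exactly \<open>R\<close> from the
        common point of the two arcs, while \<open>x\<close> and \<open>y\<close> are strictly
        closer to it: the sum of the squares stays below 3 * 4/3.\<close>
      then have "4 \<le> (norm (x - R *\<^sub>R dir \<tau>))\<^sup>2 + (norm (y - R *\<^sub>R dir \<tau>))\<^sup>2 + (norm (- (R *\<^sub>R dir \<tau>)))\<^sup>2"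
        using sep[OF xy] nrm xy by (intro sum_norm_squares_ge_4) auto
      then show False using * R2 by (simp add: power_mult_distrib)
    qed
  next
    fix x assume "x \<in> X"
    then have "0 \<le> s x" "s x \<le> 1" using s01 by auto
    then have "s x * pi \<le> 1 * pi" by (intro mult_right_mono) auto
    then show "0 \<le> s x * pi / 6 \<and> s x * pi / 6 \<le> pi" using \<open>0 \<le> s x\<close> by simp
  qed (use t in auto)
  moreover have "(\<Sum>x\<in>X. s x) * (pi / 6) = (\<Sum>x\<in>X. s x * pi / 6)"
    by (subst sum_distrib_right) simp
  ultimately have "(\<Sum>x\<in>X. s x) * (pi / 6) \<le> 6 * (pi / 6)" by simp
  then show ?thesis by (simp add: s_def)
qed

section \<open>Caps and Voronoi cells\<close>

text \<open>The normal \<open>u\<close> need not be a unit vector, so the bisector of the origin and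
  \<open>x\<close> cuts off \<open>cap \<rho> x ((norm x)\<^sup>2 / 2)\<close> without any
  division.\<close>

definition cap :: "real \<Rightarrow> real^2 \<Rightarrow> real \<Rightarrow> (real^2) set" where
  "cap \<rho> u d = {y \<in> cball 0 \<rho>. u \<bullet> y > d}"

lemma lmeasurable_cap [simp]: "cap \<rho> u d \<in> lmeasurable"
proof -
  have "cap \<rho> u d = cball 0 \<rho> \<inter> {y. u \<bullet> y > d}" by (auto simp: cap_def)
  moreover have "{y. u \<bullet> y > d} \<in> sets lebesgue"
    using open_halfspace_gt[of d u] by (intro sets_completionI_sets) (simp add: borel_open)
  ultimately show ?thesis by (simp add: fmeasurable_Int_fmeasurable)
qed

lemma cap_empty:
  assumes "\<rho> * norm u \<le> d" shows "cap \<rho> u d = {}"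
proof -
  have "u \<bullet> y \<le> d" if "norm y \<le> \<rho>" for y
  proof -
    have "u \<bullet> y \<le> norm u * norm y" by (rule norm_cauchy_schwarz)
    also have "\<dots> \<le> norm u * \<rho>" using that by (intro mult_left_mono) auto
    finally show ?thesis using assms by (simp add: mult.commute)
  qed
  then show ?thesis by (force simp: cap_def)
qed

lemma area_cap_cong_norm:
  assumes "norm u = norm v"
  shows "area (cap \<rho> u d) = area (cap \<rho> v d)"
proof -
  obtain f where f: "orthogonal_transformation f" "f u = v"
    using orthogonal_transformation_exists[OF assms] .
  have iff: "f y \<in> cap \<rho> v d \<longleftrightarrow> y \<in> cap \<rho> u d" for y
    using f orthogonal_transformation[of f]
    by (auto simp: cap_def f(2)[symmetric] orthogonal_transformation_def)
  have "y \<in> f ` cap \<rho> u d" if "y \<in> cap \<rho> v d" for y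
  proof -
    obtain z where "y = f z" using surjD[OF orthogonal_transformation_surj[OF f(1)]] by blast
    with that iff show ?thesis by blast
  qed
  with iff have "cap \<rho> v d = f ` cap \<rho> u d" by blast
  then show ?thesis using measure_orthogonal_image[OF f(1) lmeasurable_cap, of \<rho> u d] by simp
qed

text \<open>Stretching in direction \<open>u\<close> about the plane tangent to the disk at \<open>\<rho> u\<close> maps the
  smaller cap into the larger one.\<close>

lemma area_cap_le:
  fixes u :: "real^2"
  assumes "0 \<le> e" "e \<le> d" "d < \<rho>" "norm u = 1"
  shows "(\<rho> - e) * area (cap \<rho> u d) \<le> (\<rho> - d) * area (cap \<rho> u e)"
proof -
  \<comment> \<open>By rotation invariance a coordinate axis may serve as the direction, which makes
    the stretch diagonal. The factor \<open>\<kappa>\<close> takes the height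
    \<open>\<rho> - d\<close> of the smaller cap to the height \<open>\<rho> - e\<close> of the
    larger one, and the translation \<open>T\<close> after it restores
    \<open>\<rho> *\<^sub>R v\<close> as a fixed point.\<close>
  define v :: "real^2" where "v = axis 1 1"
  define \<kappa> where "\<kappa> = (\<rho> - e) / (\<rho> - d)"
  have \<kappa>: "1 \<le> \<kappa>" using assms by (simp add: \<kappa>_def)
  define m :: "2 \<Rightarrow> real" where "m k = (if k = 1 then \<kappa> else 1)" for k
  define T where "T = (+) ((\<rho> * (1 - \<kappa>)) *\<^sub>R v)"
  have vy: "v \<bullet> y = y $ 1" for y by (simp add: v_def inner_axis' )
  have sub: "T ` (\<lambda>y. \<chi> k. m k * y $ k) ` cap \<rho> v d \<subseteq> cap \<rho> v e"
  proof clarsimp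
    fix y assume "y \<in> cap \<rho> v d"
    then have y: "norm y \<le> \<rho>" "d < y $ 1" by (auto simp: cap_def vy)
    define z where "z = T (\<chi> k. m k * y $ k)"
    have z: "z $ 1 = \<rho> - \<kappa> * (\<rho> - y $ 1)" "z $ 2 = y $ 2"
      by (auto simp: z_def T_def m_def v_def axis_def algebra_simps)
    have "y $ 1 \<le> \<rho>" using y component_le_norm_cart[of y 1] by linarith
    then have "1 * (\<rho> - y $ 1) \<le> \<kappa> * (\<rho> - y $ 1)" using \<kappa> by (intro mult_right_mono) auto
    then have z1: "z $ 1 \<le> y $ 1" using z by simp
    have "\<kappa> * (\<rho> - y $ 1) < \<kappa> * (\<rho> - d)" using \<kappa> y by simp
    also have "\<dots> = \<rho> - e" using assms by (simp add: \<kappa>_def)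
    finally have z2: "e < z $ 1" using z by simp
    \<comment> \<open>The first coordinate decreases but stays above \<open>e \<ge> 0\<close>, so
      its absolute value cannot grow; this keeps the image inside the disk.\<close>
    have "norm z \<le> norm y"
      unfolding norm_vec_def L2_set_def sum_2 z(2) using z1 z2 assms(1)
      by (intro real_sqrt_le_mono add_mono power_mono) auto
    then show "T (\<chi> k. m k * y $ k) \<in> cap \<rho> v e"
      using y z2 by (simp add: cap_def vy flip: z_def)
  qed
  have "area (T ` (\<lambda>y. \<chi> k. m k * y $ k) ` cap \<rho> v d) = area ((\<lambda>y. \<chi> k. m k * y $ k) ` cap \<rho> v d)"
    unfolding T_def by (rule measure_translation)
  also have "\<dots> = \<bar>prod m UNIV\<bar> * area (cap \<rho> v d)"
    by (rule measure_stretch) simp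
  also have "prod m UNIV = \<kappa>" by (simp add: UNIV_2 m_def)
  finally have "\<kappa> * area (cap \<rho> v d) = area (T ` (\<lambda>y. \<chi> k. m k * y $ k) ` cap \<rho> v d)"
    using \<kappa> by simp
  also have "\<dots> \<le> area (cap \<rho> v e)"
  proof (rule measure_mono_fmeasurable[OF sub])
    show "T ` (\<lambda>y. \<chi> k. m k * y $ k) ` cap \<rho> v d \<in> sets lebesgue"
      unfolding T_def by (intro fmeasurableD measurable_translation measurable_stretch lmeasurable_cap)
  qed simp
  finally have "\<kappa> * area (cap \<rho> v d) * (\<rho> - d) \<le> area (cap \<rho> v e) * (\<rho> - d)"
    using assms by (intro mult_right_mono) auto
  then have "(\<rho> - e) * area (cap \<rho> v d) \<le> (\<rho> - d) * area (cap \<rho> v e)"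
    using assms by (simp add: \<kappa>_def mult_ac)
  moreover have "norm v = 1" by (simp add: v_def)
  ultimately show ?thesis using area_cap_cong_norm[of u v \<rho>] assms(4) by simp
qed

text \<open>For \<open>\<rho> < 2 / sqrt 3\<close> the six caps outside of a circumscribed hexagon are disjoint.\<close>

definition truncated_hexagon_area :: "real \<Rightarrow> real" where
  "truncated_hexagon_area \<rho> = area (cball 0 \<rho>) - 6 * area (cap \<rho> (axis 1 1) 1)"

text \<open>The cell of a center placed at the origin, with the other centers in \<open>X\<close>.
  The disk is covered by the cell and the caps of the centers closer than \<open>2 * \<rho>\<close>;
  subadditivity then charges each such center its weight times the cap area
  \<open>A\<close>.\<close>

lemma area_cell_ge:
  fixes X :: "(real^2) set"
  assumes fin: "finite X" and \<rho>: "1 < \<rho>" "\<rho> < 2 / sqrt 3"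
    and nrm: "\<And>x. x \<in> X \<Longrightarrow> 2 \<le> norm x"
    and sep: "\<And>x y. x \<in> X \<Longrightarrow> y \<in> X \<Longrightarrow> x \<noteq> y \<Longrightarrow> norm (x - y) \<ge> 2"
  shows "truncated_hexagon_area \<rho> \<le> area {y \<in> cball 0 \<rho>. \<forall>x\<in>X. x \<bullet> y \<le> (norm x)\<^sup>2 / 2}"
proof -
  define R :: real where "R = 2 / sqrt 3"
  define Y where "Y = {x \<in> X. norm x < 2 * \<rho>}"
  define A where "A = area (cap \<rho> (axis 1 1) 1)"
  define C where "C = {y \<in> cball 0 \<rho>. \<forall>x\<in>X. x \<bullet> y \<le> (norm x)\<^sup>2 / 2}"
  have Y: "finite Y" "Y \<subseteq> X" using fin by (auto simp: Y_def)
  have unit: "cap \<rho> x ((norm x)\<^sup>2 / 2) = cap \<rho> (x /\<^sub>R norm x) (norm x / 2)" if "x \<in> X" for x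
  proof -
    have "0 < norm x" using nrm[OF that] by linarith
    then have "norm x / 2 < (x \<bullet> y) / norm x \<longleftrightarrow> (norm x)\<^sup>2 / 2 < x \<bullet> y" for y
      by (simp add: pos_less_divide_eq power2_eq_square)
    moreover have "(x /\<^sub>R norm x) \<bullet> y = (x \<bullet> y) / norm x" for y
      by (simp add: divide_inverse)
    ultimately show ?thesis by (simp only: cap_def)
  qed
  have "cap \<rho> x ((norm x)\<^sup>2 / 2) = {}" if "x \<in> X - Y" for x
    using that mult_right_mono[of "2 * \<rho>" "norm x" "norm x"]
    by (intro cap_empty) (auto simp: Y_def power2_eq_square)
  then have cover: "cball 0 \<rho> = C \<union> (\<Union>x\<in>Y. cap \<rho> x ((norm x)\<^sup>2 / 2))"
    unfolding C_def cap_def Y_def by force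
  have capx: "area (cap \<rho> x ((norm x)\<^sup>2 / 2)) \<le> A * ((R - norm x / 2) / (R - 1))" if "x \<in> Y" for x
  proof -
    have x: "2 \<le> norm x" "norm x < 2 * \<rho>" "x \<in> X" using that nrm by (auto simp: Y_def)
    let ?c = "area (cap \<rho> (x /\<^sub>R norm x) (norm x / 2))"
    have 1: "norm (x /\<^sub>R norm x) = 1"
    proof -
      have "norm x \<noteq> 0" using x by linarith
      then show ?thesis by simp
    qed
    have A: "area (cap \<rho> (x /\<^sub>R norm x) 1) = A"
      unfolding A_def by (rule area_cap_cong_norm) (use 1 in simp)
    have "(\<rho> - 1) * ?c \<le> (\<rho> - norm x / 2) * A"
      using area_cap_le[of 1 "norm x / 2" \<rho> "x /\<^sub>R norm x"] x 1 A by simp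
    then have "?c \<le> A * ((\<rho> - norm x / 2) / (\<rho> - 1))" using \<rho> by (simp add: field_simps)
    also have "\<dots> \<le> A * ((R - norm x / 2) / (R - 1))"
    proof (rule mult_left_mono)
      \<comment> \<open>Written as 1 - (d - 1) / (\<rho> - 1) with d = norm x / 2 \<ge> 1, the
        factor visibly increases with \<rho>.\<close>
      have "(\<rho> - norm x / 2) / (\<rho> - 1) = 1 - (norm x / 2 - 1) / (\<rho> - 1)"
        using \<rho> by (simp add: field_simps)
      also have "\<dots> \<le> 1 - (norm x / 2 - 1) / (R - 1)"
        using \<rho> x by (simp add: R_def frac_le)
      also have "\<dots> = (R - norm x / 2) / (R - 1)"
        using \<rho> by (simp add: R_def[symmetric] field_simps)
      finally show "(\<rho> - norm x / 2) / (\<rho> - 1) \<le> (R - norm x / 2) / (R - 1)" .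
    qed (simp add: A_def)
    finally show ?thesis using unit x by simp
  qed
  have weights: "(\<Sum>x\<in>Y. (R - norm x / 2) / (R - 1)) \<le> 6"
  proof (rule sum_neighbour_weights_le_6[OF Y(1) R_def])
    show "2 \<le> norm x \<and> norm x \<le> 2 * R" if "x \<in> Y" for x
      using that nrm \<rho> by (auto simp: Y_def R_def[symmetric])
  qed (use Y sep in auto)
  have "C = cball 0 \<rho> \<inter> (\<Inter>x\<in>X. {y. x \<bullet> y \<le> (norm x)\<^sup>2 / 2})" by (auto simp: C_def)
  then have "compact C"
    by (auto intro!: compact_Int_closed closed_INT closed_halfspace_le simp del: le_divide_eq_numeral1)
  then have meas: "C \<in> lmeasurable" by (rule lmeasurable_compact)
  have "area (cball 0 \<rho>) \<le> area C + area (\<Union>x\<in>Y. cap \<rho> x ((norm x)\<^sup>2 / 2))"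
    unfolding cover using Y(1)
    by (intro measure_Un_le fmeasurableD meas fmeasurable.finite_UN) auto
  also have "area (\<Union>x\<in>Y. cap \<rho> x ((norm x)\<^sup>2 / 2)) \<le> (\<Sum>x\<in>Y. area (cap \<rho> x ((norm x)\<^sup>2 / 2)))"
    using Y(1) by (intro measure_UNION_le) (auto intro: fmeasurableD)
  also have "\<dots> \<le> (\<Sum>x\<in>Y. A * ((R - norm x / 2) / (R - 1)))" by (intro sum_mono capx)
  also have "\<dots> = A * (\<Sum>x\<in>Y. (R - norm x / 2) / (R - 1))" by (simp add: sum_distrib_left)
  also have "\<dots> \<le> A * 6" using weights by (intro mult_left_mono) (auto simp: A_def)
  finally show ?thesis by (simp add: truncated_hexagon_area_def A_def C_def)
qed

section \<open>Voronoi decomposition of a finite packing\<close>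

definition separated :: "(real^2) set \<Rightarrow> bool" where
  "separated S \<longleftrightarrow> (\<forall>x\<in>S. \<forall>y\<in>S. x \<noteq> y \<longrightarrow> 2 \<le> norm (x - y))"

lemma closer_iff_inner_le:
  fixes x c y :: "'a::real_inner"
  shows "dist y c \<le> dist y x \<longleftrightarrow> (x - c) \<bullet> (y - c) \<le> (norm (x - c))\<^sup>2 / 2"
proof -
  have "dist y c \<le> dist y x \<longleftrightarrow> (norm (y - c))\<^sup>2 \<le> (norm ((y - c) - (x - c)))\<^sup>2"
    by (simp add: dist_norm)
  also have "(norm ((y - c) - (x - c)))\<^sup>2
      = (norm (y - c))\<^sup>2 - 2 * ((x - c) \<bullet> (y - c)) + (norm (x - c))\<^sup>2"
    unfolding power2_norm_eq_inner inner_diff_left[of "y - c"] inner_diff_right[of _ "y - c"]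
    by (simp add: inner_commute)
  finally show ?thesis by auto
qed

text \<open>The truncated Voronoi cells \<open>D c\<close> lie in the union and meet pairwise only
  on bisector lines, which are null sets, so their areas add up. Every center satisfies the cell
  bound, also at the rim of the packing, hence no error term appears.\<close>

lemma area_Union_cball_ge:
  assumes fin: "finite S" and sep: "separated S" and \<rho>: "1 < \<rho>" "\<rho> < 2 / sqrt 3"
  shows "real (card S) * truncated_hexagon_area \<rho> \<le> area (\<Union>c\<in>S. cball c \<rho>)"
proof -
  define D where "D c = {y \<in> cball c \<rho>. \<forall>x\<in>S. dist y c \<le> dist y x}" for c
  have "D c = cball c \<rho> \<inter> (\<Inter>x\<in>S. {y. dist y c \<le> dist y x})" for c by (auto simp: D_def)
  then have "compact (D c)" for c
    by (auto intro!: compact_Int_closed closed_INT closed_Collect_le continuous_intros)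
  then have meas: "D c \<in> lmeasurable" for c by (rule lmeasurable_compact)
  have cell: "truncated_hexagon_area \<rho> \<le> area (D c)" if c: "c \<in> S" for c
  proof -
    let ?X = "(\<lambda>x. x - c) ` (S - {c})"
    have "truncated_hexagon_area \<rho> \<le> area {y \<in> cball 0 \<rho>. \<forall>x\<in>?X. x \<bullet> y \<le> (norm x)\<^sup>2 / 2}"
    proof (rule area_cell_ge)
      show "2 \<le> norm (x - y)" if "x \<in> ?X" "y \<in> ?X" "x \<noteq> y" for x y
        using that sep by (auto simp: separated_def)
    qed (use fin \<rho> sep c in \<open>auto simp: separated_def\<close>)
    also have "\<dots> = area ((+) c ` {y \<in> cball 0 \<rho>. \<forall>x\<in>?X. x \<bullet> y \<le> (norm x)\<^sup>2 / 2})"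
      by (rule measure_translation[symmetric])
    also have "(+) c ` {y \<in> cball 0 \<rho>. \<forall>x\<in>?X. x \<bullet> y \<le> (norm x)\<^sup>2 / 2} = D c"
    proof (rule set_eqI)
      fix z
      have "z \<in> (+) c ` {y \<in> cball 0 \<rho>. \<forall>x\<in>?X. x \<bullet> y \<le> (norm x)\<^sup>2 / 2} \<longleftrightarrow>
        z - c \<in> {y \<in> cball 0 \<rho>. \<forall>x\<in>?X. x \<bullet> y \<le> (norm x)\<^sup>2 / 2}"
        by (metis (no_types, lifting) add_diff_cancel_left' add_diff_eq image_iff)
      also have "\<dots> \<longleftrightarrow> dist z c \<le> \<rho> \<and> (\<forall>x\<in>S - {c}. dist z c \<le> dist z x)"
        unfolding closer_iff_inner_le by (simp add: dist_norm)
      also have "\<dots> \<longleftrightarrow> z \<in> D c"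
        by (auto simp: D_def dist_commute)
      finally show "z \<in> (+) c ` {y \<in> cball 0 \<rho>. \<forall>x\<in>?X. x \<bullet> y \<le> (norm x)\<^sup>2 / 2} \<longleftrightarrow> z \<in> D c" .
    qed
    finally show ?thesis .
  qed
  have neg: "negligible (D c \<inter> D x)" if "c \<in> S" "x \<in> S" "c \<noteq> x" for c x
  proof (rule negligible_subset)
    show "negligible {y. (2 *\<^sub>R (x - c)) \<bullet> y = (norm x)\<^sup>2 - (norm c)\<^sup>2}"
      using that by (intro negligible_hyperplane) auto
    show "D c \<inter> D x \<subseteq> {y. (2 *\<^sub>R (x - c)) \<bullet> y = (norm x)\<^sup>2 - (norm c)\<^sup>2}"
    proof
      fix y assume "y \<in> D c \<inter> D x"
      then have "dist y c = dist y x" using that by (auto simp: D_def intro: antisym)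
      then have "(norm (y - c))\<^sup>2 = (norm (y - x))\<^sup>2" by (simp add: dist_norm)
      then show "y \<in> {y. (2 *\<^sub>R (x - c)) \<bullet> y = (norm x)\<^sup>2 - (norm c)\<^sup>2}"
        unfolding power2_norm_eq_inner by (simp add: inner_diff_left inner_diff_right inner_commute)
    qed
  qed
  have "real (card S) * truncated_hexagon_area \<rho> = (\<Sum>c\<in>S. truncated_hexagon_area \<rho>)" by simp
  also have "\<dots> \<le> (\<Sum>c\<in>S. area (D c))" by (intro sum_mono cell)
  also have "\<dots> = area (\<Union>c\<in>S. D c)"
    using meas neg fin by (intro measure_negligible_finite_Union_image[symmetric])
      (auto simp: pairwise_def)
  also have "\<dots> \<le> area (\<Union>c\<in>S. cball c \<rho>)"
    using fin meas by (intro measure_mono_fmeasurable fmeasurable.finite_UN fmeasurableD)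
      (auto simp: D_def)
  finally show ?thesis .
qed

section \<open>Regular hexagons\<close>

lemma cos_le_cos_central:
  assumes "0 \<le> a" "a \<le> x" "x \<le> 2 * pi - a"
  shows "cos x \<le> cos a"
proof (cases "x \<le> pi")
  case True
  then show ?thesis using assms by (intro cos_monotone_0_pi_le) auto
next
  case False
  then have "cos (2 * pi - x) \<le> cos a" using assms by (intro cos_monotone_0_pi_le) auto
  then show ?thesis by (simp add: cos_diff)
qed

lemma dir_add_2pi_int: "dir (a + 2 * pi * of_int m) = dir a"
  by (simp add: dir_def cos_add sin_add)

lemma dir_hexagon_mod_6: "\<exists>k<6. dir (t + of_int m * pi / 3) = dir (t + real k * pi / 3)"
proof (intro exI conjI)
  have "real_of_int m = of_int (6 * (m div 6) + m mod 6)" by simp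
  also have "\<dots> = 6 * of_int (m div 6) + of_int (m mod 6)" by (simp only: of_int_add of_int_mult of_int_numeral)
  finally have "t + of_int m * pi / 3 = (t + real (nat (m mod 6)) * pi / 3) + 2 * pi * of_int (m div 6)"
    by (simp add: algebra_simps)
  then show "dir (t + of_int m * pi / 3) = dir (t + real (nat (m mod 6)) * pi / 3)"
    by (simp only: dir_add_2pi_int)
  show "nat (m mod 6) < 6" by simp
qed

lemma norm_dir_diff_hexagon_ge_1:
  assumes "j < 6" "k < 6" "j \<noteq> k"
  shows "norm (dir (t + real j * pi / 3) - dir (t + real k * pi / 3)) \<ge> 1"
proof -
  have "cos ((t + real j * pi / 3) - (t + real k * pi / 3)) = cos \<bar>(real j - real k) * pi / 3\<bar>"
    by (simp add: algebra_simps diff_divide_distrib)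
  also have "\<bar>(real j - real k) * pi / 3\<bar> = \<bar>real j - real k\<bar> * (pi / 3)"
    by (simp add: abs_mult)
  also have "cos (\<bar>real j - real k\<bar> * (pi / 3)) \<le> cos (pi / 3)"
  proof (rule cos_le_cos_central)
    have "1 \<le> \<bar>real j - real k\<bar>" "\<bar>real j - real k\<bar> \<le> 5" using assms by linarith+
    then have "1 * (pi / 3) \<le> \<bar>real j - real k\<bar> * (pi / 3)" "\<bar>real j - real k\<bar> * (pi / 3) \<le> 5 * (pi / 3)"
      by (intro mult_right_mono; simp)+
    then show "pi / 3 \<le> \<bar>real j - real k\<bar> * (pi / 3)"
      "\<bar>real j - real k\<bar> * (pi / 3) \<le> 2 * pi - pi / 3" by simp_all
  qed simp
  finally have "dir (t + real j * pi / 3) \<bullet> dir (t + real k * pi / 3) \<le> 1 / 2"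
    by (simp add: inner_dir_dir cos_60)
  then have "(norm (dir (t + real j * pi / 3) - dir (t + real k * pi / 3)))\<^sup>2 \<ge> 1\<^sup>2"
    unfolding power2_norm_eq_inner by (simp add: inner_diff_left inner_diff_right inner_commute inner_dir_dir)
  then show ?thesis by (rule power2_le_imp_le) simp
qed

text \<open>A point \<open>y\<close> shared by two caps would be nearer to
  \<open>2 *\<^sub>R v j\<close> and \<open>2 *\<^sub>R v k\<close> than to the origin, hence closer
  than 2 / sqrt 3 to all three of them. These are centers of mutually non-overlapping unit disks,
  which \<open>sum_norm_squares_ge_4\<close> rules out.\<close>

lemma area_hexagon_Int_cball:
  assumes "\<rho> < 2 / sqrt 3"
  shows "area {y \<in> cball 0 \<rho>. \<forall>k<6::nat. dir (t + real k * pi / 3) \<bullet> y \<le> 1} = truncated_hexagon_area \<rho>"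
proof -
  define v where "v k = dir (t + real k * pi / 3)" for k :: nat
  have disj: "cap \<rho> (v j) 1 \<inter> cap \<rho> (v k) 1 = {}" if "j < 6" "k < 6" "j \<noteq> k" for j k
  proof (rule ccontr)
    assume "\<not> ?thesis"
    then obtain y where y: "y \<in> cap \<rho> (v j) 1" "y \<in> cap \<rho> (v k) 1" by blast
    then have "norm y \<le> \<rho>" by (simp add: cap_def)
    then have "(norm y)\<^sup>2 \<le> \<rho>\<^sup>2" by (intro power_mono) auto
    moreover have "\<rho>\<^sup>2 < (2 / sqrt 3)\<^sup>2"
      using assms \<open>norm y \<le> \<rho>\<close> norm_ge_zero[of y] by (intro power_strict_mono) linarith+
    ultimately have ny: "(norm (- y))\<^sup>2 < 4 / 3" by (simp add: power_divide)
    have near: "(norm (2 *\<^sub>R v i - y))\<^sup>2 < 4 / 3" if "y \<in> cap \<rho> (v i) 1" for i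
    proof -
      have "(norm (2 *\<^sub>R v i - y))\<^sup>2 = 4 - 4 * (v i \<bullet> y) + (norm (- y))\<^sup>2"
        unfolding power2_norm_eq_inner
        by (simp add: inner_diff_left inner_diff_right inner_commute v_def inner_dir_dir)
      then show ?thesis using that ny by (simp add: cap_def)
    qed
    have "4 \<le> (norm (2 *\<^sub>R v j - y))\<^sup>2 + (norm (2 *\<^sub>R v k - y))\<^sup>2 + (norm (- y))\<^sup>2"
    proof (rule sum_norm_squares_ge_4)
      have "norm (2 *\<^sub>R v j - y - (2 *\<^sub>R v k - y)) = norm (2 *\<^sub>R (v j - v k))"
        by (simp add: scaleR_diff_right)
      also have "\<dots> \<ge> 2"
        using norm_dir_diff_hexagon_ge_1[OF that, of t] by (simp add: v_def)
      finally show "2 \<le> norm (2 *\<^sub>R v j - y - (2 *\<^sub>R v k - y))" .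
    qed (simp_all add: v_def)
    then show False using near[OF y(1)] near[OF y(2)] ny by linarith
  qed
  have "{y \<in> cball 0 \<rho>. \<forall>k<6::nat. v k \<bullet> y \<le> 1} = cball 0 \<rho> - (\<Union>k<6. cap \<rho> (v k) 1)"
    by (force simp: cap_def)
  moreover have "area (cball 0 \<rho> - (\<Union>k<6. cap \<rho> (v k) 1)) = area (cball 0 \<rho>) - area (\<Union>k<6. cap \<rho> (v k) 1)"
  proof (rule measurable_measure_Diff)
    show "(\<Union>k<6. cap \<rho> (v k) 1) \<in> sets lebesgue"
      by (intro fmeasurableD fmeasurable.finite_UN) auto
    show "(\<Union>k<6. cap \<rho> (v k) 1) \<subseteq> cball 0 \<rho>" by (auto simp: cap_def)
  qed simp
  moreover have "area (\<Union>k<6. cap \<rho> (v k) 1) = (\<Sum>k<6::nat. area (cap \<rho> (v k) 1))"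
    using disj by (intro measure_negligible_finite_Union_image) (auto simp: pairwise_def)
  moreover have "area (cap \<rho> (v k) 1) = area (cap \<rho> (axis 1 1) 1)" for k
    by (rule area_cap_cong_norm) (simp add: v_def)
  ultimately show ?thesis by (simp add: truncated_hexagon_area_def v_def)
qed

text \<open>The law of sines for a direction split along the two sides of a sector of angle
  \<open>c\<close>, multiplied by \<open>sin c\<close> to avoid a quotient. It supplies the
  barycentric coordinates within a sector of the hexagon.\<close>

lemma sin_scaleR_dir:
  "sin c *\<^sub>R dir (a + b) = sin (c - b) *\<^sub>R dir a + sin b *\<^sub>R dir (a + c)"
proof -
  have "sin c * cos (a + b) = sin (c - b) * cos a + sin b * cos (a + c)"
    "sin c * sin (a + b) = sin (c - b) * sin a + sin b * sin (a + c)"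
    by (simp_all add: cos_add sin_add sin_diff algebra_simps)
  then show ?thesis by (simp add: vec_eq_iff forall_2 dir_def)
qed

text \<open>The side normals bisect adjacent vertex directions, whence the shift by pi / 6, and
  \<open>r * (sqrt 3 / 2)\<close> is the inradius. Vertex directions and normals differ by odd
  multiples of pi / 6, so the vertices satisfy all inequalities; conversely, a point of the
  intersection lies in one of six triangles spanned by the center and two adjacent vertices.\<close>

lemma regular_hexagon_eq_halfplanes:
  assumes r: "r > 0"
  shows "convex hull ((\<lambda>k::nat. p + r *\<^sub>R dir (t + real k * pi / 3)) ` {..<6}) =
    {x. \<forall>k<6::nat. dir (t + pi / 6 + real k * pi / 3) \<bullet> (x - p) \<le> r * (sqrt 3 / 2)}"
    (is "convex hull ?V = ?Q")
proof
  have "?Q = (\<Inter>k\<in>{..<6::nat}. {x. dir (t + pi / 6 + real k * pi / 3) \<bullet> x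
      \<le> r * (sqrt 3 / 2) + dir (t + pi / 6 + real k * pi / 3) \<bullet> p})"
    by (simp only: inner_diff_right diff_le_eq) auto
  then have "convex ?Q" by (simp only: convex_INT convex_halfspace_le)
  moreover have "?V \<subseteq> ?Q"
  proof clarsimp
    fix j k :: nat assume jk: "j < 6" "k < 6"
    have "cos (t + pi / 6 + real k * pi / 3 - (t + real j * pi / 3))
        = cos \<bar>(2 * (real k - real j) + 1) * (pi / 6)\<bar>"
      unfolding cos_abs_real by (rule arg_cong[where f = cos]) (simp add: field_simps)
    also have "\<bar>(2 * (real k - real j) + 1) * (pi / 6)\<bar> = \<bar>2 * (real k - real j) + 1\<bar> * (pi / 6)"
      by (simp add: abs_mult)
    also have "cos (\<bar>2 * (real k - real j) + 1\<bar> * (pi / 6)) \<le> cos (pi / 6)"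
    proof (rule cos_le_cos_central)
      have "j \<le> k \<or> k + 1 \<le> j" by linarith
      then have "0 \<le> real k - real j \<or> real k - real j \<le> - 1" by linarith
      moreover have "\<bar>real k - real j\<bar> \<le> 5" using jk by linarith
      ultimately have "1 \<le> \<bar>2 * (real k - real j) + 1\<bar>" "\<bar>2 * (real k - real j) + 1\<bar> \<le> 11"
        by (auto simp: abs_if)
      then have "1 * (pi / 6) \<le> \<bar>2 * (real k - real j) + 1\<bar> * (pi / 6)"
        "\<bar>2 * (real k - real j) + 1\<bar> * (pi / 6) \<le> 11 * (pi / 6)"
        by (intro mult_right_mono; simp)+
      then show "pi / 6 \<le> \<bar>2 * (real k - real j) + 1\<bar> * (pi / 6)"
        "\<bar>2 * (real k - real j) + 1\<bar> * (pi / 6) \<le> 2 * pi - pi / 6" by simp_all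
    qed simp
    finally have "cos (t + pi / 6 + real k * pi / 3 - (t + real j * pi / 3)) \<le> sqrt 3 / 2"
      by (simp add: cos_30)
    then have "r * cos (t + pi / 6 + real k * pi / 3 - (t + real j * pi / 3)) \<le> r * (sqrt 3 / 2)"
      using r by (intro mult_left_mono) auto
    then show "r * (dir (t + pi / 6 + real k * pi / 3) \<bullet> dir (t + real j * pi / 3)) * 2 \<le> r * sqrt 3"
      by (simp add: inner_dir_dir)
  qed
  ultimately show "convex hull ?V \<subseteq> ?Q" by (rule hull_minimal[rotated])
next
  have V: "p + r *\<^sub>R dir (t + of_int m * pi / 3) \<in> convex hull ?V" for m
    using dir_hexagon_mod_6[of t m] by (intro hull_inc) auto
  have p: "p \<in> convex hull ?V"
  proof -
    have "dir (t + pi) = - dir t" by (simp add: dir_def vec_eq_iff forall_2)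
    then have "p = (1/2) *\<^sub>R (p + r *\<^sub>R dir (t + of_int 0 * pi / 3)) + (1/2) *\<^sub>R (p + r *\<^sub>R dir (t + of_int 3 * pi / 3))"
      by (simp add: algebra_simps flip: scaleR_add_left)
    also have "\<dots> \<in> convex hull ?V"
      by (rule convexD[OF convex_convex_hull V V]) auto
    finally show ?thesis .
  qed
  show "?Q \<subseteq> convex hull ?V"
  proof
    fix x assume x: "x \<in> ?Q"
    obtain \<phi> where \<phi>: "x - p = norm (x - p) *\<^sub>R dir \<phi>" using polar_decomposition by blast
    \<comment> \<open>\<open>m\<close> numbers the sector of angle pi / 3 that contains
      \<open>x - p\<close>, and \<beta> is the angle from its first side.\<close>
    define m where "m = \<lfloor>(\<phi> - t) / (pi / 3)\<rfloor>"
    define \<beta> where "\<beta> = \<phi> - t - of_int m * (pi / 3)"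
    have "of_int m \<le> (\<phi> - t) / (pi / 3)" "(\<phi> - t) / (pi / 3) < of_int m + 1"
      unfolding m_def by linarith+
    then have \<beta>: "0 \<le> \<beta>" "\<beta> \<le> pi / 3" unfolding \<beta>_def by (simp_all add: field_simps)
    define \<alpha> where "\<alpha> = t + of_int m * pi / 3"
    define a where "a = norm (x - p) * sin (pi / 3 - \<beta>) / (sin (pi / 3) * r)"
    define b where "b = norm (x - p) * sin \<beta> / (sin (pi / 3) * r)"
    have s3: "sin (pi / 3) > 0" by (simp add: sin_60)
    have ab: "a \<ge> 0" "b \<ge> 0"
      unfolding a_def b_def using \<beta> s3 r
      by (auto intro!: divide_nonneg_pos mult_nonneg_nonneg sin_ge_zero)
    have "dir (\<alpha> + pi / 6) \<bullet> (x - p) \<le> r * (sqrt 3 / 2)"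
    proof -
      obtain k where "k < 6" "dir ((t + pi / 6) + of_int m * pi / 3) = dir ((t + pi / 6) + real k * pi / 3)"
        using dir_hexagon_mod_6 by blast
      moreover have "(t + pi / 6) + of_int m * pi / 3 = \<alpha> + pi / 6" by (simp add: \<alpha>_def)
      ultimately show ?thesis using x by auto
    qed
    moreover have "dir (\<alpha> + pi / 6) \<bullet> (x - p) = norm (x - p) * cos (pi / 6 - \<beta>)"
    proof -
      have "\<alpha> + pi / 6 - \<phi> = pi / 6 - \<beta>" by (simp add: \<alpha>_def \<beta>_def)
      then show ?thesis using \<phi> by (metis inner_dir_dir inner_scaleR_right)
    qed
    \<comment> \<open>With this identity the inequality of the side opposite the center becomes
      \<open>a + b \<le> 1\<close>, the condition for lying in the triangle.\<close>
    moreover have "sin (pi / 3 - \<beta>) + sin \<beta> = cos (pi / 6 - \<beta>)"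
      by (simp add: sin_diff cos_diff sin_60 cos_60 sin_30 cos_30)
    ultimately have "norm (x - p) * (sin (pi / 3 - \<beta>) + sin \<beta>) \<le> sin (pi / 3) * r"
      by (simp add: sin_60 mult_ac)
    then have ab1: "a + b \<le> 1"
      unfolding a_def b_def using s3 r by (simp add: add_divide_distrib[symmetric] distrib_left[symmetric])
    have "sin (pi / 3) *\<^sub>R (x - p) = sin (pi / 3) *\<^sub>R (norm (x - p) *\<^sub>R dir \<phi>)"
      by (simp only: \<phi>[symmetric])
    also have "\<dots> = norm (x - p) *\<^sub>R (sin (pi / 3) *\<^sub>R dir (\<alpha> + \<beta>))"
      by (simp add: \<alpha>_def \<beta>_def mult.commute)
    also have "\<dots> = norm (x - p) *\<^sub>R (sin (pi / 3 - \<beta>) *\<^sub>R dir \<alpha> + sin \<beta> *\<^sub>R dir (\<alpha> + pi / 3))"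
      by (subst sin_scaleR_dir) (rule refl)
    also have "\<dots> = sin (pi / 3) *\<^sub>R (a *\<^sub>R (r *\<^sub>R dir \<alpha>) + b *\<^sub>R (r *\<^sub>R dir (\<alpha> + pi / 3)))"
      using s3 r by (simp add: a_def b_def scaleR_add_right)
    finally have "x - p = a *\<^sub>R (r *\<^sub>R dir \<alpha>) + b *\<^sub>R (r *\<^sub>R dir (\<alpha> + pi / 3))"
      using s3 by (simp only: scaleR_cancel_left) auto
    then have "x = (1 - a - b) *\<^sub>R p + a *\<^sub>R (p + r *\<^sub>R dir \<alpha>) + b *\<^sub>R (p + r *\<^sub>R dir (\<alpha> + pi / 3))"
      by (simp add: algebra_simps)
    then have "x \<in> convex hull {p, p + r *\<^sub>R dir \<alpha>, p + r *\<^sub>R dir (\<alpha> + pi / 3)}"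
      unfolding convex_hull_3 using ab ab1
      by (intro CollectI exI[of _ "1 - a - b"] exI[of _ a] exI[of _ b]) auto
    also have "\<alpha> + pi / 3 = t + of_int (m + 1) * pi / 3"
      by (simp add: \<alpha>_def algebra_simps add_divide_distrib)
    also have "convex hull {p, p + r *\<^sub>R dir \<alpha>, p + r *\<^sub>R dir (t + of_int (m + 1) * pi / 3)} \<subseteq> convex hull ?V"
      using p V[of m] V[of "m + 1"] by (intro hull_minimal convex_convex_hull) (auto simp: \<alpha>_def)
    finally show "x \<in> convex hull ?V" .
  qed
qed


text \<open>Nothing places the center of \<open>H\<close> at the origin beforehand. Containing the
  unit disk puts each side line at distance at least 1 from the origin, and touching it gives at
  most 1, so \<open>H\<close> is cut out by the six half-planes
  \<open>v k \<bullet> x \<le> 1\<close>.\<close>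

lemma area_circumscribed_hexagon:
  assumes "regular_hexagon H" "circumscribed_about H (cball 0 1)" "\<rho> < 2 / sqrt 3"
  shows "area (H \<inter> cball 0 \<rho>) = truncated_hexagon_area \<rho>"
proof -
  obtain p r t where r: "r > 0"
    and H: "H = convex hull ((\<lambda>k::nat. p + r *\<^sub>R dir (t + real k * pi / 3)) ` {..<6})"
    using assms(1) unfolding regular_hexagon_def dir_def by blast
  define v where "v k = dir (t + pi / 6 + real k * pi / 3)" for k :: nat
  have Q: "H = {x. \<forall>k<6::nat. v k \<bullet> (x - p) \<le> r * (sqrt 3 / 2)}"
    unfolding H regular_hexagon_eq_halfplanes[OF r] v_def ..
  have D: "cball 0 1 \<subseteq> H" and touch: "\<And>F. F facet_of H \<Longrightarrow> F \<inter> cball 0 1 \<noteq> {}"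
    using assms(2) by (auto simp: circumscribed_about_def)
  have dimH: "aff_dim H = 2"
  proof -
    have "interior H \<noteq> {}" using D interior_mono[of "cball 0 1" H] by auto
    then show ?thesis by (simp add: aff_dim_nonempty_interior)
  qed
  have offset: "v k \<bullet> p + r * (sqrt 3 / 2) = 1" if k: "k < 6" for k
  proof (rule antisym)
    let ?c = "v k \<bullet> p + r * (sqrt 3 / 2)"
    let ?F = "H \<inter> {x. v k \<bullet> x = ?c}"
    have "v k \<in> H" using D by (auto simp: v_def)
    then have "v k \<bullet> (v k - p) \<le> r * (sqrt 3 / 2)" using Q k by blast
    then show "1 \<le> ?c" by (simp add: inner_diff_right v_def inner_dir_dir)
    have face: "?F face_of H"
    proof (rule face_of_Int_supporting_hyperplane_le)
      show "convex H" unfolding H by (rule convex_convex_hull)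
      show "v k \<bullet> x \<le> ?c" if "x \<in> H" for x using that Q k by (auto simp: inner_diff_right algebra_simps)
    qed
    \<comment> \<open>The values 0 and 1 of \<epsilon> give the two end points of side
      \<open>k\<close>. Two distinct points make the face one-dimensional, hence a facet to which
      the touching condition applies.\<close>
    have w: "p + r *\<^sub>R dir (t + real k * pi / 3 + \<epsilon> * pi / 3) \<in> ?F" if "\<epsilon> \<in> {0, 1}" for \<epsilon> :: real
    proof -
      have "\<exists>m. t + real k * pi / 3 + \<epsilon> * pi / 3 = t + of_int m * pi / 3"
        using that by (intro exI[of _ "int k + (if \<epsilon> = 0 then 0 else 1)"])
          (auto simp: add_divide_distrib algebra_simps)
      then obtain j where "j < 6" "dir (t + real k * pi / 3 + \<epsilon> * pi / 3) = dir (t + real j * pi / 3)"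
        using dir_hexagon_mod_6 by metis
      then have "p + r *\<^sub>R dir (t + real k * pi / 3 + \<epsilon> * pi / 3) \<in> H"
        unfolding H by (intro hull_inc) auto
      moreover have "v k \<bullet> dir (t + real k * pi / 3 + \<epsilon> * pi / 3) = sqrt 3 / 2"
      proof -
        have "(t + pi / 6 + real k * pi / 3) - (t + real k * pi / 3 + \<epsilon> * pi / 3) = (if \<epsilon> = 0 then pi / 6 else - (pi / 6))"
          using that by auto
        then show ?thesis by (simp add: v_def inner_dir_dir cos_30)
      qed
      ultimately show ?thesis by (simp add: inner_add_right)
    qed
    let ?A = "p + r *\<^sub>R dir (t + real k * pi / 3 + 0 * pi / 3)"
    let ?B = "p + r *\<^sub>R dir (t + real k * pi / 3 + 1 * pi / 3)"
    have "dir (t + real k * pi / 3 + 0 * pi / 3) \<bullet> dir (t + real k * pi / 3 + 1 * pi / 3) = 1 / 2"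
      by (simp add: inner_dir_dir cos_60)
    moreover have "dir s \<bullet> dir s = 1" for s by (simp add: inner_dir_dir)
    ultimately have "?A \<noteq> ?B" using r by auto
    then have "1 = aff_dim {?A, ?B}" by (simp only: aff_dim_2) simp
    also have "\<dots> \<le> aff_dim ?F" using w[of 0] w[of 1] by (intro aff_dim_subset) auto
    finally have ge: "1 \<le> aff_dim ?F" .
    have "v k \<noteq> 0" using norm_dir by (metis norm_zero v_def zero_neq_one)
    then have "aff_dim {x. v k \<bullet> x = ?c} = 1" by simp
    moreover have "aff_dim ?F \<le> aff_dim {x. v k \<bullet> x = ?c}" by (intro aff_dim_subset) auto
    ultimately have "?F facet_of H"
      using face ge dimH w[of 0] unfolding facet_of_def by auto
    then obtain x where x: "norm x \<le> 1" "v k \<bullet> x = ?c" using touch by fastforce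
    have "v k \<bullet> x \<le> norm (v k) * norm x" by (rule norm_cauchy_schwarz)
    then show "?c \<le> 1" using x by (simp add: v_def)
  qed
  have "v k \<bullet> (x - p) \<le> r * (sqrt 3 / 2) \<longleftrightarrow> v k \<bullet> x \<le> 1" if "k < 6" for x k
    unfolding inner_diff_right using offset[OF that] by linarith
  then have "H \<inter> cball 0 \<rho> = {x \<in> cball 0 \<rho>. \<forall>k<6::nat. dir (t + pi / 6 + real k * pi / 3) \<bullet> x \<le> 1}"
    unfolding Q v_def by auto
  then show ?thesis by (simp only: area_hexagon_Int_cball[OF assms(3)])
qed

section \<open>Existence of an optimal packing\<close>

lemma lmeasurable_Union_cball [simp]:
  "finite S \<Longrightarrow> (\<Union>c\<in>S. cball (f c) \<rho>) \<in> lmeasurable"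
  by (intro fmeasurable.finite_UN) auto

lemma area_Union_cball_translate:
  fixes S :: "(real^2) set"
  shows "area (\<Union>c\<in>(+) v ` S. cball c \<rho>) = area (\<Union>c\<in>S. cball c \<rho>)"
proof -
  have "(\<Union>c\<in>(+) v ` S. cball c \<rho>) = (+) v ` (\<Union>c\<in>S. cball c \<rho>)"
    unfolding image_UN image_image cball_translation[symmetric] ..
  then have "area (\<Union>c\<in>(+) v ` S. cball c \<rho>) = area ((+) v ` (\<Union>c\<in>S. cball c \<rho>))"
    by (rule arg_cong[where f = area])
  also have "\<dots> = area (\<Union>c\<in>S. cball c \<rho>)" by (rule measure_translation)
  finally show ?thesis .
qed

lemma separated_translate: "separated S \<Longrightarrow> separated ((+) v ` S)"
  by (auto simp: separated_def)

text \<open>If the centers spread too far around one of them, then by the pigeonhole principle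
  some annulus of width \<open>2 \<rho>\<close> contains none, and the centers inside and outside of it can be
  moved independently.\<close>

lemma separated_bounded_rearrangement:
  assumes \<rho>: "\<rho> > 0"
  shows "\<exists>M. \<forall>S. finite S \<and> card S = n \<and> separated S \<longrightarrow>
    (\<exists>S'. finite S' \<and> card S' = n \<and> separated S' \<and> S' \<subseteq> cball 0 M \<and>
      area (\<Union>c\<in>S'. cball c \<rho>) \<le> area (\<Union>c\<in>S. cball c \<rho>))"
proof (induction n rule: less_induct)
  case (less n)
  define Q where "Q S S' M \<longleftrightarrow> finite S' \<and> card S' = card S \<and> separated S' \<and> S' \<subseteq> cball 0 M \<and>
      area (\<Union>c\<in>S'. cball c \<rho>) \<le> area (\<Union>c\<in>S. cball c \<rho>)" for S S' M
  have "\<forall>k. \<exists>M. k < n \<longrightarrow> (\<forall>S. finite S \<and> card S = k \<and> separated S \<longrightarrow> (\<exists>S'. Q S S' M))"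
    using less unfolding Q_def by metis
  then obtain m where m: "\<And>k S. k < n \<Longrightarrow> finite S \<Longrightarrow> card S = k \<Longrightarrow> separated S \<Longrightarrow> \<exists>S'. Q S S' (m k)"
    by metis
  define M where "M = (\<Sum>k<n. \<bar>m k\<bar>)"
  have M: "\<exists>S'. Q S S' M" if "finite S" "card S < n" "separated S" for S
  proof -
    have "m (card S) \<le> \<bar>m (card S)\<bar>" by simp
    also have "\<dots> \<le> M" unfolding M_def using that by (intro member_le_sum) auto
    finally have "cball 0 (m (card S)) \<subseteq> (cball 0 M :: (real^2) set)" by (rule subset_cball)
    then show ?thesis using m[OF that(2,1) refl that(3)] unfolding Q_def by blast
  qed
  have M0: "M \<ge> 0" unfolding M_def by (intro sum_nonneg) auto
  \<comment> \<open>Both rearranged clusters lie within \<open>M\<close> of the origin, so a shift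
    by \<open>L\<close> leaves a gap of at least \<open>2 * \<rho> + 2\<close> between them.\<close>
  define L where "L = 2 * M + 2 * \<rho> + 2"
  have "\<exists>S'. Q S S' (M + L + 2 * \<rho> * real n)" if S: "finite S" "card S = n" "separated S" for S
  proof (cases "S = {}")
    case True
    then show ?thesis by (intro exI[of _ "{}"]) (auto simp: Q_def separated_def)
  next
    case False
    then obtain a where a: "a \<in> S" by blast
    \<comment> \<open>The index of the annulus of width \<open>2 * \<rho>\<close> about
      \<open>a\<close> that contains \<open>x\<close>. Among the n + 1 annuli 0, ..., n at least one
      is missed by the \<open>n\<close> centers.\<close>
    define g where "g x = nat \<lfloor>dist x a / (2 * \<rho>)\<rfloor>" for x
    have g: "2 * \<rho> * real (g x) \<le> dist x a" "dist x a < 2 * \<rho> * (real (g x) + 1)" for x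
    proof -
      have "real (g x) = of_int \<lfloor>dist x a / (2 * \<rho>)\<rfloor>" using \<rho> by (simp add: g_def)
      then have "real (g x) \<le> dist x a / (2 * \<rho>)" "dist x a / (2 * \<rho>) < real (g x) + 1" by linarith+
      then show "2 * \<rho> * real (g x) \<le> dist x a" "dist x a < 2 * \<rho> * (real (g x) + 1)"
        using \<rho> by (simp_all add: field_simps)
    qed
    have "\<not> {..n} \<subseteq> g ` S"
    proof
      assume "{..n} \<subseteq> g ` S"
      then have "card {..n} \<le> card (g ` S)" using S by (intro card_mono) auto
      also have "\<dots> \<le> n" using card_image_le[OF S(1), of g] S by simp
      finally show False by simp
    qed
    then obtain k where k: "k \<le> n" "k \<notin> g ` S" by auto
    define A where "A = {x \<in> S. g x < k}"
    define B where "B = {x \<in> S. g x > k}"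
    have AB: "S = A \<union> B" "A \<inter> B = {}" "finite A" "finite B"
      using k S by (auto simp: A_def B_def neq_iff image_iff)
    have far: "dist x y > 2 * \<rho>" if "x \<in> A" "y \<in> B" for x y
    proof -
      have "real (g x) + 1 \<le> real k" "real k + 1 \<le> real (g y)" using that by (auto simp: A_def B_def)
      then have "2 * \<rho> * (real (g x) + 1) \<le> 2 * \<rho> * real k" "2 * \<rho> * (real k + 1) \<le> 2 * \<rho> * real (g y)"
        using \<rho> by (simp_all)
      then have "dist x a < 2 * \<rho> * real k" "2 * \<rho> * real k + 2 * \<rho> \<le> dist y a"
        using g[of x] g[of y] by (auto simp: algebra_simps)
      then show ?thesis using dist_triangle[of y a x] by (simp add: dist_commute)
    qed
    \<comment> \<open>Annulus 0 contains \<open>a\<close>, so the missed annulus lies further out.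
      Thus \<open>A\<close> is nonempty, and if \<open>B\<close> is nonempty as well, both are
      smaller than \<open>S\<close> and the induction hypothesis applies.\<close>
    have aA: "a \<in> A"
    proof -
      have "g a = 0" by (simp add: g_def)
      then show ?thesis using a k by (cases k) (auto simp: A_def image_iff)
    qed
    show ?thesis
    proof (cases "B = {}")
      case True
      have "(+) (- a) ` S \<subseteq> cball 0 (M + L + 2 * \<rho> * real n)"
      proof clarsimp
        fix x assume "x \<in> S"
        then have "x \<in> A" using True AB(1) by blast
        then have "g x < n" using k(1) by (simp add: A_def)
        then have "real (g x) + 1 \<le> real n" by simp
        then have "2 * \<rho> * (real (g x) + 1) \<le> 2 * \<rho> * real n" using \<rho> by simp
        then have "norm (x - a) \<le> 2 * \<rho> * real n"
          using g(2)[of x] unfolding dist_norm by linarith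
        moreover have "0 \<le> M + L" using M0 \<rho> by (simp add: L_def)
        ultimately show "norm (x - a) \<le> M + L + 2 * \<rho> * real n" by linarith
      qed
      moreover have "card ((+) (- a) ` S) = card S" by (simp add: card_image)
      ultimately show ?thesis
        using S area_Union_cball_translate[where v = "- a" and S = S and \<rho> = \<rho>] separated_translate[of S "- a"]
        by (intro exI[of _ "(+) (- a) ` S"]) (auto simp: Q_def)
    next
      case False
      have cards: "card A + card B = n" using AB S card_Un_disjoint by metis
      have "card A > 0" "card B > 0" using aA False AB(3,4) by (auto simp: card_gt_0_iff)
      moreover have "separated A" "separated B" using S(3) by (auto simp: separated_def A_def B_def)
      ultimately obtain A' B' where A': "Q A A' M" and B': "Q B B' M"
        using M[of A] M[of B] AB(3,4) cards by auto
      define v :: "real^2" where "v = L *\<^sub>R axis 1 1"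
      define B'' where "B'' = (+) v ` B'"
      have nv: "norm v = L" using M0 \<rho> by (simp add: v_def L_def)
      have far': "norm (x - y) \<ge> 2" if "x \<in> A'" "y \<in> B''" for x y
      proof -
        obtain z where z: "y = v + z" "z \<in> B'" using \<open>y \<in> B''\<close> by (auto simp: B''_def)
        have "norm x \<le> M" "norm z \<le> M" using A' B' that z by (auto simp: Q_def)
        moreover have "norm v \<le> norm (x - y) + norm x + norm z"
          using norm_triangle_ineq4[of x "x - y"] norm_triangle_ineq4[of y z] z by simp
        ultimately show ?thesis using nv \<rho> by (simp add: L_def)
      qed
      have disj: "A' \<inter> B'' = {}" using far' by fastforce
      have fin: "finite A'" "finite B''" using A' B' by (auto simp: Q_def B''_def)
      have "Q S (A' \<union> B'') (M + L + 2 * \<rho> * real n)"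
        unfolding Q_def
      proof (intro conjI)
        show "finite (A' \<union> B'')" using fin by simp
        have "card B'' = card B'" by (simp add: B''_def card_image)
        then show "card (A' \<union> B'') = card S"
          using fin disj A' B' cards S by (simp add: card_Un_disjoint Q_def)
        have "separated A'" "separated B''"
          using A' B' separated_translate by (auto simp: Q_def B''_def)
        then show "separated (A' \<union> B'')"
          using far' by (auto simp: separated_def) (metis norm_minus_commute)
        show "A' \<union> B'' \<subseteq> cball 0 (M + L + 2 * \<rho> * real n)"
        proof
          fix x assume "x \<in> A' \<union> B''"
          then have "norm x \<le> M + L"
          proof
            assume "x \<in> A'"
            then show ?thesis using A' M0 \<rho> by (auto simp: Q_def L_def)
          next
            assume "x \<in> B''"
            then obtain z where "x = v + z" "norm z \<le> M" using B' by (auto simp: B''_def Q_def)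
            then show ?thesis using norm_triangle_ineq[of v z] nv by simp
          qed
          moreover have "0 \<le> 2 * \<rho> * real n" using \<rho> by simp
          ultimately show "x \<in> cball 0 (M + L + 2 * \<rho> * real n)" by simp
        qed
        \<comment> \<open>For the new clusters subadditivity is enough; the old ones have disjoint
          disks across the empty annulus, so there the areas add exactly.\<close>
        have "area (\<Union>c\<in>A' \<union> B''. cball c \<rho>) \<le> area (\<Union>c\<in>A'. cball c \<rho>) + area (\<Union>c\<in>B''. cball c \<rho>)"
          using fin unfolding UN_Un by (intro measure_Un_le fmeasurableD) (auto intro: lmeasurable_Union_cball[where f = "\<lambda>x. x"])
        also have "\<dots> \<le> area (\<Union>c\<in>A. cball c \<rho>) + area (\<Union>c\<in>B. cball c \<rho>)"
          using A' B' unfolding Q_def B''_def area_Union_cball_translate by simp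
        also have "\<dots> = area ((\<Union>c\<in>A. cball c \<rho>) \<union> (\<Union>c\<in>B. cball c \<rho>))"
        proof -
          have "(\<Union>c\<in>A. cball c \<rho>) \<inter> (\<Union>c\<in>B. cball c \<rho>) = {}"
          proof (rule ccontr)
            assume "\<not> ?thesis"
            then obtain x y z where xyz: "x \<in> A" "y \<in> B" "dist x z \<le> \<rho>" "dist y z \<le> \<rho>" by auto
            then show False using far[of x y] dist_triangle2[of x y z] by linarith
          qed
          then show ?thesis using AB(3,4) by (subst measure_Un3) auto
        qed
        also have "\<dots> = area (\<Union>c\<in>S. cball c \<rho>)" unfolding AB(1) UN_Un ..
        finally show "area (\<Union>c\<in>A' \<union> B''. cball c \<rho>) \<le> area (\<Union>c\<in>S. cball c \<rho>)" .
      qed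
      then show ?thesis by blast
    qed
  qed
  note rearrange = this
  show ?case
  proof (rule exI, intro allI impI)
    fix S :: "(real^2) set" assume S: "finite S \<and> card S = n \<and> separated S"
    then obtain S' where "Q S S' (M + L + 2 * \<rho> * real n)" using rearrange by blast
    then show "\<exists>S'. finite S' \<and> card S' = n \<and> separated S' \<and>
        S' \<subseteq> cball 0 (M + L + 2 * \<rho> * real n) \<and>
        area (\<Union>c\<in>S'. cball c \<rho>) \<le> area (\<Union>c\<in>S. cball c \<rho>)"
      using S by (intro exI[of _ S']) (simp add: Q_def)
  qed
qed

section \<open>Limits of packings\<close>

lemma convergent_subsequence_coordinates:
  fixes f :: "nat \<Rightarrow> nat \<Rightarrow> 'a::heine_borel"
  assumes "\<And>i. i < n \<Longrightarrow> bounded (range (\<lambda>k. f k i))"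
  shows "\<exists>r l. strict_mono r \<and> (\<forall>i<n. (\<lambda>k. f (r k) i) \<longlonglongrightarrow> l i)"
  using assms
proof (induction n)
  case 0
  show ?case by (intro exI[of _ id]) (auto simp: strict_mono_def)
next
  case (Suc n)
  then obtain r l where r: "strict_mono r" "\<And>i. i < n \<Longrightarrow> (\<lambda>k. f (r k) i) \<longlonglongrightarrow> l i" by auto
  have "bounded (range (\<lambda>k. f (r k) n))"
    using Suc.prems[of n] by (rule bounded_subset) auto
  then obtain x s where s: "strict_mono s" "((\<lambda>k. f (r k) n) \<circ> s) \<longlonglongrightarrow> x"
    using bounded_imp_convergent_subsequence by blast
  have "(\<lambda>k. f ((r \<circ> s) k) i) \<longlonglongrightarrow> (l(n := x)) i" if "i < Suc n" for i
  proof (cases "i = n")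
    case True then show ?thesis using s by (simp add: o_def)
  next
    case False
    then have "((\<lambda>k. f (r k) i) \<circ> s) \<longlonglongrightarrow> l i"
      using r(2)[of i] s(1) that by (intro LIMSEQ_subseq_LIMSEQ) auto
    then show ?thesis using False by (simp add: o_def)
  qed
  then show ?case using strict_mono_o[OF r(1) s(1)] by blast
qed

lemma area_Union_cball_eq_Union_ball:
  fixes f :: "'i \<Rightarrow> real^2"
  assumes "finite I"
  shows "area (\<Union>i\<in>I. cball (f i) \<rho>) = area (\<Union>i\<in>I. ball (f i) \<rho>)"
proof (rule antisym)
  have neg: "negligible (\<Union>i\<in>I. sphere (f i) \<rho>)"
    using assms by (intro negligible_Union) (auto intro: negligible_sphere)
  have "(\<Union>i\<in>I. cball (f i) \<rho>) = (\<Union>i\<in>I. ball (f i) \<rho>) \<union> (\<Union>i\<in>I. sphere (f i) \<rho>)"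
    by fastforce
  also have "area \<dots> \<le> area (\<Union>i\<in>I. ball (f i) \<rho>) + area (\<Union>i\<in>I. sphere (f i) \<rho>)"
  proof (rule measure_Un_le)
    show "(\<Union>i\<in>I. ball (f i) \<rho>) \<in> sets lebesgue"
      using assms by (intro fmeasurableD fmeasurable.finite_UN) auto
    show "(\<Union>i\<in>I. sphere (f i) \<rho>) \<in> sets lebesgue"
      using neg by (intro fmeasurableD negligible_imp_measurable)
  qed
  finally show "area (\<Union>i\<in>I. cball (f i) \<rho>) \<le> area (\<Union>i\<in>I. ball (f i) \<rho>)"
    using negligible_imp_measure0[OF neg] by simp
  show "area (\<Union>i\<in>I. ball (f i) \<rho>) \<le> area (\<Union>i\<in>I. cball (f i) \<rho>)"
    using assms by (intro measure_mono_fmeasurable fmeasurable.finite_UN fmeasurableD) auto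
qed

text \<open>Lower semicontinuity of the area, which is what a minimizer requires. Slightly shrunk
  disks about the limit centers eventually lie inside the approximating disks; the shrunk disks
  exhaust the open disks, which differ from the closed ones by a null set.\<close>

lemma area_Union_cball_le_of_tendsto:
  fixes c :: "nat \<Rightarrow> nat \<Rightarrow> real^2"
  assumes lim: "\<And>i. i < n \<Longrightarrow> (\<lambda>k. c k i) \<longlonglongrightarrow> l i"
    and area: "(\<lambda>k. area (\<Union>i<n. cball (c k i) \<rho>)) \<longlonglongrightarrow> a"
  shows "area (\<Union>i<n. cball (l i) \<rho>) \<le> a"
proof -
  define A where "A m = (\<Union>i<n. cball (l i) (\<rho> - 1 / (real m + 1)))" for m :: nat
  have le: "area (A m) \<le> a" for m
  proof (rule tendsto_lowerbound[OF area])
    have "\<forall>\<^sub>F k in sequentially. \<forall>i\<in>{..<n}. dist (c k i) (l i) < 1 / (real m + 1)"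
      using lim by (intro eventually_ball_finite) (auto intro!: tendstoD)
    then show "\<forall>\<^sub>F k in sequentially. area (A m) \<le> area (\<Union>i<n. cball (c k i) \<rho>)"
    proof eventually_elim
      case (elim k)
      have "A m \<subseteq> (\<Union>i<n. cball (c k i) \<rho>)"
      proof
        fix x assume "x \<in> A m"
        then obtain i where i: "i < n" "dist (l i) x \<le> \<rho> - 1 / (real m + 1)" by (auto simp: A_def)
        then have "dist (c k i) x \<le> \<rho>"
          using elim dist_triangle[of "c k i" x "l i"] by force
        then show "x \<in> (\<Union>i<n. cball (c k i) \<rho>)" using i by auto
      qed
      then show ?case unfolding A_def by (intro measure_mono_fmeasurable fmeasurableD) auto
    qed
  qed simp
  have Un: "(\<Union>m. A m) = (\<Union>i<n. ball (l i) \<rho>)"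
  proof (intro equalityI subsetI)
    fix x assume "x \<in> (\<Union>i<n. ball (l i) \<rho>)"
    then obtain i where i: "i < n" "0 < \<rho> - dist (l i) x" by auto
    then obtain m where "inverse (real (Suc m)) < \<rho> - dist (l i) x" using reals_Archimedean by blast
    then have "dist (l i) x \<le> \<rho> - 1 / (real m + 1)" by (simp add: inverse_eq_divide add.commute)
    then show "x \<in> (\<Union>m. A m)" using i by (auto simp: A_def)
  next
    fix x assume "x \<in> (\<Union>m. A m)"
    then obtain i m where i: "i < n" "dist (l i) x \<le> \<rho> - 1 / (real m + 1)" by (auto simp: A_def)
    moreover have "0 < 1 / (real m + 1)" by simp
    ultimately have "dist (l i) x < \<rho>" by linarith
    then show "x \<in> (\<Union>i<n. ball (l i) \<rho>)" using i by auto
  qed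
  have "(\<lambda>m. area (A m)) \<longlonglongrightarrow> area (\<Union>m. A m)"
  proof (rule Lim_measure_incseq)
    show "range A \<subseteq> sets lebesgue" unfolding A_def by (auto intro!: fmeasurableD)
    show "incseq A"
    proof (rule monoI)
      fix j k :: nat assume "j \<le> k"
      then have "1 / (real k + 1) \<le> 1 / (real j + 1)" by (intro divide_left_mono) auto
      then show "A j \<subseteq> A k" unfolding A_def by (intro UN_mono subset_cball) auto
    qed
    have "(\<Union>i<n. ball (l i) \<rho>) \<in> lmeasurable" by (intro fmeasurable.finite_UN) auto
    then show "emeasure lebesgue (\<Union>m. A m) \<noteq> \<infinity>" unfolding Un infinity_ennreal_def by (rule fmeasurableD2)
  qed
  then have "area (\<Union>m. A m) \<le> a" using le by (intro LIMSEQ_le_const2) auto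
  then show ?thesis unfolding Un area_Union_cball_eq_Union_ball[OF finite_lessThan] .
qed

section \<open>Indexed packings and the minimizer\<close>

lemma separated_image_packing:
  assumes "unit_disk_packing n c"
  shows "separated (c ` {..<n})" "card (c ` {..<n}) = n"
proof -
  have far: "norm (c j - c k) \<ge> 2" if "j < n" "k < n" "j \<noteq> k" for j k
    using assms that unfolding unit_disk_packing_def by (metis linorder_neqE_nat norm_minus_commute)
  then show "separated (c ` {..<n})" by (auto simp: separated_def)
  have "inj_on c {..<n}" using far by (force simp: inj_on_def)
  then show "card (c ` {..<n}) = n" by (simp add: card_image)
qed

lemma packing_of_separated:
  assumes "finite S" "separated S"
  obtains c where "unit_disk_packing (card S) c" "c ` {..<card S} = S"
proof -
  obtain c where c: "bij_betw c {..<card S} S"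
    using ex_bij_betw_nat_finite[OF assms(1)] by (auto simp: atLeast0LessThan)
  then have "unit_disk_packing (card S) c"
    unfolding unit_disk_packing_def
  proof (intro allI impI)
    fix j k assume jk: "j < k \<and> k < card S"
    then have "c j \<noteq> c k" using c by (auto simp: bij_betw_def inj_on_def)
    moreover have "c j \<in> S" "c k \<in> S" using c jk by (auto simp: bij_betw_def)
    ultimately show "2 \<le> norm (c j - c k)" using assms(2) by (auto simp: separated_def)
  qed
  with c show ?thesis using that by (auto simp: bij_betw_def)
qed

lemma exists_packing: "\<exists>c. unit_disk_packing n c"
proof
  show "unit_disk_packing n (\<lambda>i. (2 * real i) *\<^sub>R axis 1 1)"
    unfolding unit_disk_packing_def
  proof (intro allI impI)
    fix j k :: nat assume "j < k \<and> k < n"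
    then have "\<bar>2 * real j - 2 * real k\<bar> \<ge> 2" by simp
    then show "2 \<le> norm ((2 * real j) *\<^sub>R axis 1 1 - (2 * real k) *\<^sub>R axis 1 1 :: real^2)"
      by (simp flip: scaleR_diff_left)
  qed
qed

lemma packing_of_tendsto:
  assumes "\<And>k. unit_disk_packing n (c k)" "\<And>i. i < n \<Longrightarrow> (\<lambda>k. c k i) \<longlonglongrightarrow> l i"
  shows "unit_disk_packing n l"
  unfolding unit_disk_packing_def
proof (intro allI impI)
  fix i j assume ij: "i < j \<and> j < n"
  then have "(\<lambda>k. norm (c k i - c k j)) \<longlonglongrightarrow> norm (l i - l j)"
    using assms(2) by (intro tendsto_intros) auto
  then show "2 \<le> norm (l i - l j)"
    by (rule LIMSEQ_le_const) (use assms(1) ij in \<open>auto simp: unit_disk_packing_def\<close>)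
qed

text \<open>The direct method: rearrangement moves a minimizing sequence into a fixed ball at no
  cost in area, a subsequence of its centers converges, and the separation conditions, being closed,
  pass to the limit.\<close>

lemma exists_packing_min_area:
  assumes \<rho>: "\<rho> > 0"
  shows "\<exists>c. unit_disk_packing n c \<and> (\<forall>c'. unit_disk_packing n c' \<longrightarrow>
    area (\<Union>i<n. cball (c i) \<rho>) \<le> area (\<Union>i<n. cball (c' i) \<rho>))"
proof -
  define F where "F c = area (\<Union>i<n. cball (c i) \<rho>)" for c :: "nat \<Rightarrow> real^2"
  define I where "I = Inf (F ` {c. unit_disk_packing n c})"
  obtain M where M: "\<And>S. finite S \<and> card S = n \<and> separated S \<Longrightarrow>
    (\<exists>S'. finite S' \<and> card S' = n \<and> separated S' \<and> S' \<subseteq> cball 0 M \<and>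
      area (\<Union>c\<in>S'. cball c \<rho>) \<le> area (\<Union>c\<in>S. cball c \<rho>))"
    using separated_bounded_rearrangement[OF \<rho>, of n] by blast
  have bdd: "bdd_below (F ` {c. unit_disk_packing n c})"
    by (rule bdd_belowI[of _ 0]) (auto simp: F_def)
  have I: "I \<le> F c" if "unit_disk_packing n c" for c
    unfolding I_def using bdd that by (intro cInf_lower) auto
  have "\<exists>c. unit_disk_packing n c \<and> F c < I + 1 / (real k + 1) \<and> c ` {..<n} \<subseteq> cball 0 M" for k :: nat
  proof -
    have "\<exists>y\<in>F ` {c. unit_disk_packing n c}. y < I + 1 / (real k + 1)"
      unfolding I_def using exists_packing[of n] by (intro cInf_lessD) auto
    then obtain c where c: "unit_disk_packing n c" "F c < I + 1 / (real k + 1)" by auto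
    obtain S where S: "finite S" "card S = n" "separated S" "S \<subseteq> cball 0 M"
      "area (\<Union>c\<in>S. cball c \<rho>) \<le> F c"
      using M[of "c ` {..<n}"] separated_image_packing[OF c(1)] unfolding F_def by auto
    obtain c' where "unit_disk_packing n c'" "c' ` {..<n} = S"
      using packing_of_separated[OF S(1,3)] S(2) by metis
    moreover then have "F c' \<le> F c" using S(5) by (auto simp: F_def)
    ultimately show ?thesis using c(2) S(4) by (intro exI[of _ c']) auto
  qed
  then obtain c where c: "\<And>k. unit_disk_packing n (c k)" "\<And>k. F (c k) < I + 1 / (real k + 1)"
    "\<And>k. c k ` {..<n} \<subseteq> cball 0 M" by metis
  have "bounded (range (\<lambda>k. c k i))" if "i < n" for i
    using c(3) that by (intro bounded_subset[OF bounded_cball[of 0 M]]) auto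
  then obtain r l where r: "strict_mono r" "\<And>i. i < n \<Longrightarrow> (\<lambda>k. c (r k) i) \<longlonglongrightarrow> l i"
    using convergent_subsequence_coordinates[of n c] by blast
  have "(\<lambda>k. F (c k)) \<longlonglongrightarrow> I"
  proof (rule tendsto_sandwich)
    show "\<forall>\<^sub>F k in sequentially. I \<le> F (c k)" using I c(1) by simp
    show "\<forall>\<^sub>F k in sequentially. F (c k) \<le> I + 1 / (real k + 1)" using c(2) by (simp add: less_imp_le)
    have "(\<lambda>k. I + 1 / real (Suc k)) \<longlonglongrightarrow> I + 0" by (intro tendsto_intros LIMSEQ_Suc lim_1_over_n)
    then show "(\<lambda>k. I + 1 / (real k + 1)) \<longlonglongrightarrow> I" by (simp add: add.commute)
  qed simp
  then have "((\<lambda>k. F (c k)) \<circ> r) \<longlonglongrightarrow> I" using r(1) by (rule LIMSEQ_subseq_LIMSEQ)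
  then have "F l \<le> I"
    unfolding F_def o_def by (intro area_Union_cball_le_of_tendsto[OF r(2)]) auto
  moreover have "unit_disk_packing n l" by (rule packing_of_tendsto[OF c(1) r(2)])
  ultimately show ?thesis using I unfolding F_def by (meson order_trans)
qed

section \<open>Hexagonal lattice packings and the limit\<close>

lemma compact_truncated_hexagon:
  "compact {y \<in> cball 0 \<rho>. \<forall>k<6::nat. dir (t + real k * pi / 3) \<bullet> y \<le> 1}"
proof -
  have "{y \<in> cball 0 \<rho>. \<forall>k<6::nat. dir (t + real k * pi / 3) \<bullet> y \<le> 1}
    = cball 0 \<rho> \<inter> (\<Inter>k\<in>{..<6::nat}. {y. dir (t + real k * pi / 3) \<bullet> y \<le> 1})" by auto
  then show ?thesis by (simp add: compact_Int_closed closed_INT closed_halfspace_le)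
qed

lemma truncated_hexagon_area_pos:
  assumes "1 < \<rho>" "\<rho> < 2 / sqrt 3"
  shows "truncated_hexagon_area \<rho> > 0"
proof -
  have "dir s \<bullet> y \<le> 1" if "norm y \<le> 1" for s y
    using norm_cauchy_schwarz[of "dir s" y] that by simp
  then have "cball 0 1 \<subseteq> {y \<in> cball 0 \<rho>. \<forall>k<6::nat. dir (0 + real k * pi / 3) \<bullet> y \<le> 1}"
    using assms by auto
  then have "area (cball 0 1) \<le> area {y \<in> cball 0 \<rho>. \<forall>k<6::nat. dir (0 + real k * pi / 3) \<bullet> y \<le> 1}"
    using compact_truncated_hexagon[of \<rho> 0]
    by (intro measure_mono_fmeasurable fmeasurableD) (auto intro: lmeasurable_compact)
  moreover have "area (cball 0 1) > 0" by simp
  ultimately show ?thesis using area_hexagon_Int_cball[OF assms(2), of 0] by linarith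
qed

text \<open>The hexagonal lattice of minimal distance 2. Natural coordinates suffice, since only
  finite rhombic patches of it are used.\<close>

definition lattice_point :: "nat \<times> nat \<Rightarrow> real^2" where
  "lattice_point p = (2 * real (fst p)) *\<^sub>R dir 0 + (2 * real (snd p)) *\<^sub>R dir (pi / 3)"

text \<open>The squared distance is 4 times the integral form a^2 + a b + b^2. Completing the square
  shows that the form is positive for distinct points, and an integer that is positive is at least
  1.\<close>

lemma norm_lattice_point_diff_ge_2:
  assumes "p \<noteq> q"
  shows "norm (lattice_point p - lattice_point q) \<ge> 2"
proof -
  define a where "a = int (fst p) - int (fst q)"
  define b where "b = int (snd p) - int (snd q)"
  have "a \<noteq> 0 \<or> b \<noteq> 0" using assms by (auto simp: a_def b_def prod_eq_iff)
  then have "0 < (2 * a + b)\<^sup>2 + 3 * b\<^sup>2"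
    by (cases "b = 0") (auto intro: add_nonneg_pos)
  also have "(2 * a + b)\<^sup>2 + 3 * b\<^sup>2 = 4 * (a\<^sup>2 + a * b + b\<^sup>2)" by (simp add: power2_eq_square algebra_simps)
  finally have "1 \<le> a\<^sup>2 + a * b + b\<^sup>2" by simp
  then have "1 \<le> real_of_int (a\<^sup>2 + a * b + b\<^sup>2)" by linarith
  moreover have "lattice_point p - lattice_point q = (2 * of_int a) *\<^sub>R dir 0 + (2 * of_int b) *\<^sub>R dir (pi / 3)"
    by (simp add: lattice_point_def a_def b_def algebra_simps)
  then have "(norm (lattice_point p - lattice_point q))\<^sup>2 = 4 * real_of_int (a\<^sup>2 + a * b + b\<^sup>2)"
    unfolding power2_norm_eq_inner
    by (simp add: inner_add_left inner_add_right inner_dir_dir cos_60 power2_eq_square algebra_simps)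
  ultimately have "2\<^sup>2 \<le> (norm (lattice_point p - lattice_point q))\<^sup>2" by simp
  then show ?thesis by (rule power2_le_imp_le) simp
qed

lemma inj_lattice_point: "inj lattice_point"
proof (rule injI, rule ccontr)
  fix p q assume "lattice_point p = lattice_point q" "p \<noteq> q"
  then show False using norm_lattice_point_diff_ge_2[of p q] by simp
qed

text \<open>The base point is written with \<open>Suc\<close> so that neighbours with a smaller
  coordinate still have natural indices. The upper bounds keep all six neighbours of an inner point
  within the patch.\<close>

lemma lattice_point_neighbour:
  assumes "k < 6"
  shows "\<exists>q. fst q \<le> Suc (Suc i) \<and> snd q \<le> Suc (Suc j) \<and>
    lattice_point q = lattice_point (Suc i, Suc j) + 2 *\<^sub>R dir (real k * pi / 3)"
proof -
  have d: "dir (2 * pi / 3) = dir (pi / 3) - dir 0" "dir pi = - dir 0"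
    "dir (4 * pi / 3) = - dir (pi / 3)" "dir (5 * pi / 3) = dir 0 - dir (pi / 3)"
  proof -
    have *: "dir (x + pi) = - dir x" for x by (simp add: dir_def vec_eq_iff forall_2)
    show 2: "dir (2 * pi / 3) = dir (pi / 3) - dir 0"
      by (simp add: dir_def vec_eq_iff forall_2 cos_60 sin_60 cos_120 sin_120)
    show "dir pi = - dir 0" using *[of 0] by simp
    have "4 * pi / 3 = pi / 3 + pi" by simp
    then show "dir (4 * pi / 3) = - dir (pi / 3)" by (simp only: *)
    have "5 * pi / 3 = 2 * pi / 3 + pi" by simp
    then show "dir (5 * pi / 3) = dir 0 - dir (pi / 3)" by (simp only: * 2) simp
  qed
  consider "k = 0" | "k = 1" | "k = 2" | "k = 3" | "k = 4" | "k = 5" using assms by linarith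
  then show ?thesis
  proof cases
    case 1 then show ?thesis
      by (intro exI[of _ "(Suc (Suc i), Suc j)"]) (simp add: lattice_point_def vec_eq_iff algebra_simps)
  next
    case 2 then show ?thesis
      by (intro exI[of _ "(Suc i, Suc (Suc j))"]) (simp add: lattice_point_def vec_eq_iff algebra_simps)
  next
    case 3
    then have e: "dir (real k * pi / 3) = dir (pi / 3) - dir 0" using d by simp
    show ?thesis unfolding e
      by (intro exI[of _ "(i, Suc (Suc j))"]) (simp add: lattice_point_def vec_eq_iff algebra_simps)
  next
    case 4
    then have e: "dir (real k * pi / 3) = - dir 0" using d by simp
    show ?thesis unfolding e
      by (intro exI[of _ "(i, Suc j)"]) (simp add: lattice_point_def vec_eq_iff algebra_simps)
  next
    case 5
    then have e: "dir (real k * pi / 3) = - dir (pi / 3)" using d by simp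
    show ?thesis unfolding e
      by (intro exI[of _ "(Suc i, j)"]) (simp add: lattice_point_def vec_eq_iff algebra_simps)
  next
    case 6
    then have e: "dir (real k * pi / 3) = dir 0 - dir (pi / 3)" using d by simp
    show ?thesis unfolding e
      by (intro exI[of _ "(Suc (Suc i), j)"]) (simp add: lattice_point_def vec_eq_iff algebra_simps)
  qed
qed

text \<open>Each covered point is assigned to a nearest center of the patch. Inner centers have all
  six neighbours in the patch, so they receive only points of their truncated hexagon; each of the 4
  k + 4 rim centers is charged a whole disk, a cost linear in \<open>k\<close> against k^2
  hexagons.\<close>

lemma lattice_packing_area_le:
  assumes "\<rho> < 2 / sqrt 3"
  shows "area (\<Union>c\<in>lattice_point ` ({..<k+2} \<times> {..<k+2}). cball c \<rho>) \<le>
    (real k)\<^sup>2 * truncated_hexagon_area \<rho> + (4 * real k + 4) * area (cball 0 \<rho>)"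
proof -
  define I where "I = {..<k+2} \<times> {..<k+2}"
  define J where "J = {1..<k+1} \<times> {1..<k+1}"
  define T where "T = {y \<in> cball 0 \<rho>. \<forall>k<6::nat. dir (0 + real k * pi / 3) \<bullet> y \<le> 1}"
  have fin: "finite I" "finite J" "J \<subseteq> I" by (auto simp: I_def J_def)
  have T: "T \<in> lmeasurable"
    unfolding T_def by (rule lmeasurable_compact[OF compact_truncated_hexagon])
  have sub: "(\<Union>c\<in>lattice_point ` I. cball c \<rho>) \<subseteq>
      (\<Union>p\<in>J. (+) (lattice_point p) ` T) \<union> (\<Union>p\<in>I - J. cball (lattice_point p) \<rho>)"
  proof
    fix y assume "y \<in> (\<Union>c\<in>lattice_point ` I. cball c \<rho>)"
    then obtain q where q: "q \<in> I" "dist y (lattice_point q) \<le> \<rho>" by (auto simp: dist_commute)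
    define p where "p = arg_min_on (\<lambda>p. dist y (lattice_point p)) I"
    have p: "p \<in> I" "\<And>s. s \<in> I \<Longrightarrow> dist y (lattice_point p) \<le> dist y (lattice_point s)"
      using arg_min_if_finite(1)[OF fin(1), of "\<lambda>p. dist y (lattice_point p)"] q(1)
        arg_min_least[OF fin(1), of _ "\<lambda>p. dist y (lattice_point p)"] unfolding p_def by auto
    have y: "dist y (lattice_point p) \<le> \<rho>" using p(2)[OF q(1)] q(2) by linarith
    show "y \<in> (\<Union>p\<in>J. (+) (lattice_point p) ` T) \<union> (\<Union>p\<in>I - J. cball (lattice_point p) \<rho>)"
    proof (cases "p \<in> J")
      case False
      then show ?thesis using p(1) y by (auto simp: dist_commute)
    next
      case True
      then obtain i j where ij: "p = (Suc i, Suc j)" "i < k" "j < k"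
        unfolding J_def by (cases p) (auto elim!: less_natE simp: Suc_le_eq gr0_conv_Suc)
      have "dir (0 + real l * pi / 3) \<bullet> (y - lattice_point p) \<le> 1" if l: "l < 6" for l
      proof -
        obtain s where s: "fst s \<le> Suc (Suc i)" "snd s \<le> Suc (Suc j)"
          "lattice_point s = lattice_point p + 2 *\<^sub>R dir (real l * pi / 3)"
          using lattice_point_neighbour[OF l] ij(1) by blast
        have "s \<in> I" using s(1,2) ij by (cases s) (auto simp: I_def)
        from p(2)[OF this] show ?thesis
          unfolding closer_iff_inner_le s(3) by simp
      qed
      then have "y - lattice_point p \<in> T" using y by (simp add: T_def dist_norm)
      then have "y \<in> (+) (lattice_point p) ` T" by (intro image_eqI[of _ _ "y - lattice_point p"]) auto
      then show ?thesis using True by blast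
    qed
  qed
  have m: "(\<Union>p\<in>J. (+) (lattice_point p) ` T) \<in> lmeasurable"
    "(\<Union>p\<in>I - J. cball (lattice_point p) \<rho>) \<in> lmeasurable"
    using fin T measurable_translation by (auto intro!: fmeasurable.finite_UN)
  have "area (\<Union>c\<in>lattice_point ` I. cball c \<rho>) \<le>
      area ((\<Union>p\<in>J. (+) (lattice_point p) ` T) \<union> (\<Union>p\<in>I - J. cball (lattice_point p) \<rho>))"
    using fin m sub by (intro measure_mono_fmeasurable fmeasurableD fmeasurable.Un)
      (auto intro!: fmeasurable.finite_UN)
  also have "\<dots> \<le> area (\<Union>p\<in>J. (+) (lattice_point p) ` T) + area (\<Union>p\<in>I - J. cball (lattice_point p) \<rho>)"
    using m by (intro measure_Un_le fmeasurableD)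
  also have "area (\<Union>p\<in>J. (+) (lattice_point p) ` T) \<le> (\<Sum>p\<in>J. area ((+) (lattice_point p) ` T))"
    using fin T measurable_translation by (intro measure_UNION_le fmeasurableD) auto
  also have "\<dots> = real (card J) * area T" by (simp add: measure_translation)
  also have "area (\<Union>p\<in>I - J. cball (lattice_point p) \<rho>) \<le> (\<Sum>p\<in>I - J. area (cball (lattice_point p) \<rho>))"
    using fin by (intro measure_UNION_le fmeasurableD) auto
  also have "\<dots> = (\<Sum>p\<in>I - J. area (cball 0 \<rho>))"
  proof (rule sum.cong[OF refl])
    fix p show "area (cball (lattice_point p) \<rho>) = area (cball 0 \<rho>)"
      using measure_translation[of "lattice_point p" "cball 0 \<rho>"] cball_translation[of "lattice_point p" 0 \<rho>]
      by simp
  qed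
  also have "\<dots> = real (card (I - J)) * area (cball 0 \<rho>)" by simp
  also have "card J = k * k" by (simp add: J_def card_cartesian_product)
  also have "card (I - J) = 4 * k + 4"
  proof -
    have "card (I - J) = card I - card J" using fin by (intro card_Diff_subset) auto
    also have "\<dots> = (k + 2) * (k + 2) - k * k" by (simp add: I_def J_def card_cartesian_product)
    also have "\<dots> = 4 * k + 4" by (simp add: algebra_simps)
    finally show ?thesis .
  qed
  also have "area T = truncated_hexagon_area \<rho>"
    unfolding T_def by (rule area_hexagon_Int_cball[OF assms])
  finally show ?thesis by (simp add: I_def power2_eq_square)
qed

section \<open>Soft densities of finite packings\<close>

lemma packing_area_ge:
  assumes "1 < \<rho>" "\<rho> < 2 / sqrt 3" "unit_disk_packing n c"
  shows "real n * truncated_hexagon_area \<rho> \<le> area (\<Union>i<n. cball (c i) \<rho>)"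
proof -
  have "real (card (c ` {..<n})) * truncated_hexagon_area \<rho> \<le> area (\<Union>x\<in>c ` {..<n}. cball x \<rho>)"
    using separated_image_packing(1)[OF assms(3)] assms(1,2) by (intro area_Union_cball_ge) auto
  then show ?thesis unfolding separated_image_packing(2)[OF assms(3)] image_image .
qed

text \<open>With \<open>n\<close> fixed the density decreases in the area, so the packing of least
  area realizes the \<open>GREATEST\<close>. The cell bound also keeps the areas positive, as
  comparing the quotients requires.\<close>

lemma max_soft_density_props:
  assumes lam: "0 < lam" "1 + lam < 2 / sqrt 3" and n: "n > 0"
  shows "max_soft_density n lam \<le> pi / truncated_hexagon_area (1 + lam)"
    and "\<And>c. unit_disk_packing n c \<Longrightarrow> packing_soft_density n lam c \<le> max_soft_density n lam"
proof -
  define A where "A = truncated_hexagon_area (1 + lam)"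
  have A: "A > 0" unfolding A_def using lam by (intro truncated_hexagon_area_pos) auto
  have ge: "real n * A \<le> area (\<Union>i<n. cball (c i) (1 + lam))" if "unit_disk_packing n c" for c
    unfolding A_def using packing_area_ge[OF _ lam(2) that] lam by simp
  have pos: "0 < real n * A" using n A by simp
  obtain c where c: "unit_disk_packing n c"
    "\<And>c'. unit_disk_packing n c' \<Longrightarrow>
      area (\<Union>i<n. cball (c i) (1 + lam)) \<le> area (\<Union>i<n. cball (c' i) (1 + lam))"
    using exists_packing_min_area[of "1 + lam" n] lam by auto
  have le: "packing_soft_density n lam c' \<le> packing_soft_density n lam c" if "unit_disk_packing n c'" for c'
    unfolding packing_soft_density_def using c(2)[OF that] ge[OF c(1)] pos
    by (intro divide_left_mono) auto
  have max: "max_soft_density n lam = packing_soft_density n lam c"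
    unfolding max_soft_density_def using c(1) le by (intro Greatest_equality) auto
  have "packing_soft_density n lam c \<le> real n * pi / (real n * A)"
    unfolding packing_soft_density_def using ge[OF c(1)] pos by (intro divide_left_mono) auto
  then show "max_soft_density n lam \<le> pi / truncated_hexagon_area (1 + lam)"
    using n by (simp add: max A_def)
  show "packing_soft_density n lam c' \<le> max_soft_density n lam" if "unit_disk_packing n c'" for c'
    using le[OF that] max by simp
qed

lemma max_soft_density_square_ge:
  assumes lam: "0 < lam" "1 + lam < 2 / sqrt 3"
  shows "real ((k + 2)\<^sup>2) * pi / ((real k)\<^sup>2 * truncated_hexagon_area (1 + lam)
    + (4 * real k + 4) * area (cball 0 (1 + lam))) \<le> max_soft_density ((k + 2)\<^sup>2) lam"
proof -
  let ?S = "lattice_point ` ({..<k+2} \<times> {..<k+2})"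
  have "card ?S = card ({..<k+2} \<times> {..<k+2})"
    by (intro card_image inj_on_subset[OF inj_lattice_point]) auto
  then have card: "card ?S = (k + 2)\<^sup>2" by (simp add: power2_eq_square)
  have "separated ?S"
    by (auto simp: separated_def intro!: norm_lattice_point_diff_ge_2)
  then obtain c where "unit_disk_packing (card ?S) c" "c ` {..<card ?S} = ?S"
    using packing_of_separated[of ?S] by blast
  then have c: "unit_disk_packing ((k + 2)\<^sup>2) c" "c ` {..<(k + 2)\<^sup>2} = ?S"
    unfolding card .
  have "(\<Union>i<(k + 2)\<^sup>2. cball (c i) (1 + lam)) = (\<Union>x\<in>?S. cball x (1 + lam))"
    unfolding c(2)[symmetric] by simp
  then have "area (\<Union>i<(k + 2)\<^sup>2. cball (c i) (1 + lam)) \<le> (real k)\<^sup>2 * truncated_hexagon_area (1 + lam)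
    + (4 * real k + 4) * area (cball 0 (1 + lam))"
    using lattice_packing_area_le[OF lam(2), of k] by simp
  moreover have "0 < real ((k + 2)\<^sup>2) * truncated_hexagon_area (1 + lam)"
    using truncated_hexagon_area_pos[OF _ lam(2)] lam by simp
  then have "0 < area (\<Union>i<(k + 2)\<^sup>2. cball (c i) (1 + lam))"
    using packing_area_ge[OF _ lam(2) c(1)] lam by simp
  ultimately have "real ((k + 2)\<^sup>2) * pi / ((real k)\<^sup>2 * truncated_hexagon_area (1 + lam)
    + (4 * real k + 4) * area (cball 0 (1 + lam))) \<le> packing_soft_density ((k + 2)\<^sup>2) lam c"
    unfolding packing_soft_density_def by (intro divide_left_mono) auto
  also have "\<dots> \<le> max_soft_density ((k + 2)\<^sup>2) lam"
    by (rule max_soft_density_props(2)[OF lam _ c(1)]) simp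
  finally show ?thesis .
qed

theorem theorem3:
  fixes lam :: real and H :: "(real^2) set"
  assumes "0 < lam" and "lam < 2 / sqrt 3 - 1"
    and "regular_hexagon H" and "circumscribed_about H (cball 0 1)"
  shows "soft_density lam = ereal (pi / area (H \<inter> cball 0 (1 + lam)))"
proof -
  define A where "A = truncated_hexagon_area (1 + lam)"
  define B where "B = area (cball 0 (1 + lam))"
  have lam: "0 < lam" "1 + lam < 2 / sqrt 3" using assms(1,2) by auto
  have A: "A > 0" unfolding A_def using lam by (intro truncated_hexagon_area_pos) auto
  have B: "B > 0" unfolding B_def using lam by simp
  let ?X = "\<lambda>n. ereal (max_soft_density n lam)"
  let ?L = "\<lambda>k. real ((k + 2)\<^sup>2) * pi / ((real k)\<^sup>2 * A + (4 * real k + 4) * B)"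
  have "limsup ?X \<le> ereal (pi / A)"
  proof (rule Limsup_bounded)
    show "\<forall>\<^sub>F n in sequentially. ?X n \<le> ereal (pi / A)"
      using max_soft_density_props(1)[OF lam] unfolding A_def
      by (intro eventually_mono[OF eventually_gt_at_top[of 0]]) simp
  qed
  \<comment> \<open>Square numbers of disks form a subsequence, which bounds the limsup from below.
    Along it the rim term, linear in \<open>k\<close>, vanishes against the quadratic main
    term.\<close>
  moreover have "ereal (pi / A) \<le> limsup ?X"
  proof -
    have "?L \<longlonglongrightarrow> pi * inverse A" using A B by real_asymp
    then have "?L \<longlonglongrightarrow> pi / A" by (simp only: divide_inverse)
    then have "ereal (pi / A) = limsup (\<lambda>k. ereal (?L k))"
      by (intro lim_imp_Limsup[symmetric]) auto
    also have "\<dots> \<le> limsup (?X \<circ> (\<lambda>k. (k + 2)\<^sup>2))"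
      using max_soft_density_square_ge[OF lam] by (intro Limsup_mono) (simp add: A_def B_def)
    also have "\<dots> \<le> limsup ?X"
      by (intro limsup_subseq_mono strict_monoI) (simp add: power_strict_mono)
    finally show ?thesis .
  qed
  ultimately show ?thesis
    unfolding soft_density_def area_circumscribed_hexagon[OF assms(3,4) lam(2)] A_def
    by (rule antisym)
qed

end
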